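(* Let $n\in\mathbb{N}_0$ and $\Gamma,\eta>0$. Then there exists an integer $N=N(n,\Gamma,\eta)$ such that for any operator $T: SL^\infty_N\to SL^\infty_N$ with $\|T\|\le\Gamma$ there exist operators $R: SL^\infty_n\to SL^\infty_N$ and $S: SL^\infty_N\to SL^\infty_n$ such that for either $H=T$ or $H=\mathrm{Id}_{SL^\infty_N}-T$ we have $$S\,H\,R=\mathrm{Id}_{SL^\infty_n}.$$ Moreover, it is possible to choose the operators $R$ and $S$ in such a way that $\|R\|\,\|S\|\le 2+\eta$.
   Context: All spaces are over the real scalars. $\mathcal{D}=\{[(k-1)2^{-m},k2^{-m}) : m\in\mathbb{N}_0,\ 1\le k\le 2^m\}$ is the collection of dyadic intervals in $[0,1)$; $|\cdot|$ is Lebesgue measure; $\mathcal{D}_m=\{I\in\mathcal{D}:|I|=2^{-m}\}$ and $\mathcal{D}^m=\bigcup_{k=0}^m\mathcal{D}_k$. For $I\in\mathcal{D}$ with left half $I_0$ and right half $I_1$, the $L^\infty$-normalized Haar function is $h_I=\chi_{I_0}-\chi_{I_1}$. $SL^\infty$ is the space of all $f=\sum_{I\in\mathcal{D}}a_Ih_I\in L^2$ ($a_I\in\mathbb{R}$) with finite norm $$\|f\|_{SL^\infty}=\Big\|\Big(\sum_{I\in\mathcal{D}}a_I^2h_I^2\Big)^{1/2}\Big\|_{L^\infty}.$$ For $m\in\mathbb{N}_0$, $SL^\infty_m=\mathrm{span}\{h_I:I\in\mathcal{D}^m\}\subset SL^\infty$, with the norm of $SL^\infty$. "Operator" means bounded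 linear map between Banach spaces, with $\|\cdot\|$ the operator norm. *)

theory Defs
  imports "HOL-Analysis.Analysis" "HOL-Probability.Essential_Supremum"
begin

definition dyadic_intervals :: "real set set" where
  "dyadic_intervals = {{(real k - 1) / 2 ^ m ..< real k / 2 ^ m} | (m::nat) (k::nat). 1 \<le> k \<and> k \<le> 2 ^ m}"

definition dyadic_level :: "nat \<Rightarrow> real set set" where
  "dyadic_level m = {I \<in> dyadic_intervals. measure lebesgue I = 1 / 2 ^ m}"

definition dyadic_upto :: "nat \<Rightarrow> real set set" where
  "dyadic_upto m = (\<Union>k\<le>m. dyadic_level k)"

definition left_half :: "real set \<Rightarrow> real set" where
  "left_half I = {Inf I ..< (Inf I + Sup I) / 2}"

definition right_half :: "real set \<Rightarrow> real set" where
  "right_half I = {(Inf I + Sup I) / 2 ..< Sup I}"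

definition haar :: "real set \<Rightarrow> real \<Rightarrow> real" where
  "haar I x = indicator (left_half I) x - indicator (right_half I) x"

text \<open>
  The coefficient \<open>a\<^sub>I\<close> in the expansion \<open>f = (\<Sum>I. a\<^sub>I h\<^sub>I)\<close>: the Haar functions are orthogonal with
  \<open>\<integral> h\<^sub>I\<^sup>2 = |I|\<close>.  For finite expansions this is lemma \<open>haar_coeff_sum\<close> below.
\<close>

definition haar_coeff :: "(real \<Rightarrow> real) \<Rightarrow> real set \<Rightarrow> real" where
  "haar_coeff f I = (LINT x|lebesgue_on {0..<1}. f x * haar I x) / measure lebesgue I"

definition square_function :: "(real \<Rightarrow> real) \<Rightarrow> real \<Rightarrow> ereal" where
  "square_function f x =
     (if (\<lambda>I. (haar_coeff f I)\<^sup>2 * (haar I x)\<^sup>2) summable_on dyadic_intervals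
      then ereal (sqrt (\<Sum>\<^sub>\<infinity>I\<in>dyadic_intervals. (haar_coeff f I)\<^sup>2 * (haar I x)\<^sup>2))
      else \<infinity>)"

text \<open>
  \<open>real_of_ereal\<close> sends \<open>\<infinity>\<close> to \<open>0\<close>, so this is the norm only where the essential supremum is
  finite, which is the case on all the spaces \<open>SL m\<close>.
\<close>

definition SL_norm :: "(real \<Rightarrow> real) \<Rightarrow> real" where
  "SL_norm f = real_of_ereal (esssup (lebesgue_on {0..<1}) (square_function f))"

text \<open>
  The linear span of the finite family of Haar functions up to level \<open>m\<close>.  No quotient by
  null sets is needed: by \<open>haar_coeff_sum\<close>, elements that agree almost everywhere have
  the same coefficients and are therefore equal.
\<close>

definition SL :: "nat \<Rightarrow> (real \<Rightarrow> real) set" where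
  "SL m = {f. \<exists>a :: real set \<Rightarrow> real. f = (\<lambda>x. \<Sum>I\<in>dyadic_upto m. a I * haar I x)}"

text \<open>
  Bounded linear maps between linear subspaces \<open>X\<close> and \<open>Y\<close> of \<open>SL\<^sup>\<infinity>\<close>; values outside \<open>X\<close> are
  irrelevant.  The norm mirrors \<open>onorm\<close>, restricted to \<open>X\<close> (the quotient is \<open>0\<close> at \<open>f = 0\<close>).
\<close>

definition SL_operator ::
    "(real \<Rightarrow> real) set \<Rightarrow> (real \<Rightarrow> real) set \<Rightarrow> ((real \<Rightarrow> real) \<Rightarrow> (real \<Rightarrow> real)) \<Rightarrow> bool" where
  "SL_operator X Y T \<longleftrightarrow>
     (\<forall>f\<in>X. T f \<in> Y) \<and>
     (\<forall>f\<in>X. \<forall>g\<in>X. T (\<lambda>x. f x + g x) = (\<lambda>x. T f x + T g x)) \<and>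
     (\<forall>f\<in>X. \<forall>c::real. T (\<lambda>x. c * f x) = (\<lambda>x. c * T f x)) \<and>
     (\<exists>K. \<forall>f\<in>X. SL_norm (T f) \<le> K * SL_norm f)"

definition SL_opnorm ::
    "(real \<Rightarrow> real) set \<Rightarrow> ((real \<Rightarrow> real) \<Rightarrow> (real \<Rightarrow> real)) \<Rightarrow> real" where
  "SL_opnorm X T = (SUP f\<in>X. SL_norm (T f) / SL_norm f)"

lemma dyadic_cases:
  assumes "I \<in> dyadic_intervals"
  obtains m i :: nat where "I = {real i / 2 ^ m ..< (real i + 1) / 2 ^ m}" "i < 2 ^ m"
proof -
  from assms obtain m k :: nat where "I = {(real k - 1) / 2 ^ m ..< real k / 2 ^ m}" "1 \<le> k" "k \<le> 2 ^ m"
    unfolding dyadic_intervals_def by blast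
  then show ?thesis using that[of "k - 1" m] by (simp add: of_nat_diff)
qed

lemma haar_Ico:
  assumes "a < b"
  shows "haar {a..<b} = (\<lambda>x. indicator {a..<(a + b) / 2} x - indicator {(a + b) / 2..<b} x)"
  using assms by (simp add: haar_def left_half_def right_half_def fun_eq_iff)

lemma dyadic_Ico:
  assumes "I \<in> dyadic_intervals"
  obtains a b where "I = {a..<b}" "0 \<le> a" "a < b" "b \<le> 1"
proof -
  from dyadic_cases[OF assms] obtain m i :: nat
    where I: "I = {real i / 2 ^ m ..< (real i + 1) / 2 ^ m}" and i: "i < 2 ^ m" by metis
  have "real i + 1 \<le> 2 ^ m" using i
    by (metis Suc_leI add.commute of_nat_Suc of_nat_le_iff of_nat_numeral of_nat_power)
  then show ?thesis by (intro that[OF I]) (auto simp: field_simps)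
qed

lemma dyadic_subset: "I \<in> dyadic_intervals \<Longrightarrow> I \<subseteq> {0..<1}"
  by (erule dyadic_Ico) auto

lemma haar_square: "I \<in> dyadic_intervals \<Longrightarrow> haar I x * haar I x = indicator I x"
  by (erule dyadic_Ico) (auto simp: haar_Ico indicator_def)

lemma haar_outside: "I \<in> dyadic_intervals \<Longrightarrow> x \<notin> I \<Longrightarrow> haar I x = 0"
  by (erule dyadic_Ico) (auto simp: haar_Ico indicator_def)

lemma integral_indicator_Ico_unit:
  assumes "0 \<le> a" "a \<le> b" "b \<le> (1::real)"
  shows "integrable (lebesgue_on {0..<1}) (indicator {a..<b} :: real \<Rightarrow> real)"
    and "(LINT x|lebesgue_on {0..<1}. indicator {a..<b} x :: real) = b - a"
proof -
  have *: "indicat_real {0..<1} x * indicat_real {a..<b} x = indicat_real {a..<b} x" for x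
    using assms by (auto simp: indicator_def)
  show "integrable (lebesgue_on {0..<1}) (indicator {a..<b} :: real \<Rightarrow> real)"
    by (subst integrable_restrict_space) (use assms in \<open>auto simp: * emeasure_lborel_Ico\<close>)
  show "(LINT x|lebesgue_on {0..<1}. indicator {a..<b} x :: real) = b - a"
    by (subst integral_restrict_space) (use assms in \<open>auto simp: *\<close>)
qed

lemma integral_haar:
  assumes "I \<in> dyadic_intervals"
  shows "integrable (lebesgue_on {0..<1}) (haar I)" "(LINT x|lebesgue_on {0..<1}. haar I x) = 0"
proof -
  obtain a b where ab: "I = {a..<b}" "0 \<le> a" "a < b" "b \<le> 1" using dyadic_Ico[OF assms] .
  let ?c = "(a + b) / 2"
  have 1: "0 \<le> a" "a \<le> ?c" "?c \<le> 1" and 2: "0 \<le> ?c" "?c \<le> b" "b \<le> 1" using ab by auto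
  show "integrable (lebesgue_on {0..<1}) (haar I)"
    unfolding ab(1) haar_Ico[OF ab(3)]
    by (intro Bochner_Integration.integrable_diff integral_indicator_Ico_unit 1 2)
  show "(LINT x|lebesgue_on {0..<1}. haar I x) = 0"
    unfolding ab(1) haar_Ico[OF ab(3)]
    by (subst Bochner_Integration.integral_diff)
      (use integral_indicator_Ico_unit[OF 1] integral_indicator_Ico_unit[OF 2] in \<open>auto simp: field_simps\<close>)
qed

lemma dyadic_nested:
  fixes i j a b :: nat
  assumes "a \<le> b"
  defines "I \<equiv> {real i / 2 ^ a ..< (real i + 1) / 2 ^ a}"
    and "J \<equiv> {real j / 2 ^ b ..< (real j + 1) / 2 ^ b}"
  shows "J \<subseteq> I \<or> I \<inter> J = {}"
proof -
  obtain d where d: "b = a + d" using assms(1) le_iff_add by blast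
  have e: "real i / 2 ^ a = real (i * 2 ^ d) / 2 ^ b" "(real i + 1) / 2 ^ a = real ((i + 1) * 2 ^ d) / 2 ^ b"
    by (simp_all add: d power_add field_simps)
  have j: "(real j + 1) / 2 ^ b = real (j + 1) / 2 ^ b" by simp
  consider "j + 1 \<le> i * 2 ^ d" | "(i + 1) * 2 ^ d \<le> j" | "i * 2 ^ d \<le> j" "j + 1 \<le> (i + 1) * 2 ^ d"
    by linarith
  then show ?thesis
  proof cases
    case 1
    then have "(real j + 1) / 2 ^ b \<le> real i / 2 ^ a"
      unfolding e j by (intro divide_right_mono of_nat_mono) auto
    then show ?thesis unfolding I_def J_def by auto
  next
    case 2
    then have "(real i + 1) / 2 ^ a \<le> real j / 2 ^ b"
      unfolding e j by (intro divide_right_mono of_nat_mono) auto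
    then show ?thesis unfolding I_def J_def by auto
  next
    case 3
    have "real i / 2 ^ a \<le> real j / 2 ^ b"
      unfolding e by (intro divide_right_mono of_nat_mono 3) auto
    moreover have "(real j + 1) / 2 ^ b \<le> (real i + 1) / 2 ^ a"
      unfolding e j by (intro divide_right_mono of_nat_mono 3) auto
    ultimately show ?thesis unfolding I_def J_def by auto
  qed
qed

lemma haar_mult_finer:
  fixes i j a b :: nat
  assumes "a < b"
  defines "I \<equiv> {real i / 2 ^ a ..< (real i + 1) / 2 ^ a}"
    and "J \<equiv> {real j / 2 ^ b ..< (real j + 1) / 2 ^ b}"
  shows "\<exists>c. \<forall>x. haar I x * haar J x = c * haar J x"
proof -
  let ?L = "{real (2 * i) / 2 ^ Suc a ..< (real (2 * i) + 1) / 2 ^ Suc a}"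
  let ?R = "{real (2 * i + 1) / 2 ^ Suc a ..< (real (2 * i + 1) + 1) / 2 ^ Suc a}"
  have hI: "haar I x = indicator ?L x - indicator ?R x" for x
    unfolding I_def by (subst haar_Ico) (auto simp: field_simps indicator_def)
  have hJ: "haar J x = 0" if "x \<notin> J" for x
    using that unfolding J_def by (subst haar_Ico) (auto simp: field_simps indicator_def)
  have ab: "Suc a \<le> b" using assms(1) by simp
  have dis: "?L \<inter> ?R = {}" by (auto simp: field_simps)
  have L: "J \<subseteq> ?L \<or> ?L \<inter> J = {}" and R: "J \<subseteq> ?R \<or> ?R \<inter> J = {}"
    unfolding J_def by (intro dyadic_nested ab)+
  then have "\<exists>c. \<forall>x\<in>J. haar I x = c"
  proof -
    consider "J \<subseteq> ?L" | "J \<subseteq> ?R" | "?L \<inter> J = {}" "?R \<inter> J = {}" using L R by blast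
    then show ?thesis
    proof cases
      case 1
      then have "\<forall>x\<in>J. haar I x = 1" using dis unfolding hI indicator_def by auto
      then show ?thesis by blast
    next
      case 2
      then have "\<forall>x\<in>J. haar I x = -1" using dis unfolding hI indicator_def by auto
      then show ?thesis by blast
    next
      case 3
      then have "\<forall>x\<in>J. haar I x = 0" unfolding hI indicator_def by auto
      then show ?thesis by blast
    qed
  qed
  then show ?thesis using hJ by (metis mult_zero_right)
qed

lemma haar_mult_distinct:
  assumes "I \<in> dyadic_intervals" "J \<in> dyadic_intervals" "I \<noteq> J"
  shows "\<exists>K\<in>{I, J}. \<exists>c. \<forall>x. haar I x * haar J x = c * haar K x"
proof -
  obtain a i where I: "I = {real i / 2 ^ a ..< (real i + 1) / 2 ^ a}" using dyadic_cases[OF assms(1)] by metis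
  obtain b j where J: "J = {real j / 2 ^ b ..< (real j + 1) / 2 ^ b}" using dyadic_cases[OF assms(2)] by metis
  consider "a < b" | "b < a" | "a = b" by linarith
  then show ?thesis
  proof cases
    case 1
    then show ?thesis using haar_mult_finer[OF 1, of i j] unfolding I J by blast
  next
    case 2
    then show ?thesis using haar_mult_finer[OF 2, of j i] unfolding I J by (simp add: mult.commute)
  next
    case 3
    have "I \<inter> J = {}"
      using dyadic_nested[of a b i j] dyadic_nested[of b a j i] assms(3) unfolding I J 3 by blast
    then have "\<forall>x. haar I x * haar J x = 0 * haar I x"
      using haar_outside[OF assms(1)] haar_outside[OF assms(2)] by (metis disjoint_iff mult_eq_0_iff)
    then show ?thesis by blast
  qed
qed

lemma haar_orthogonal:
  assumes "I \<in> dyadic_intervals" "J \<in> dyadic_intervals"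
  shows "integrable (lebesgue_on {0..<1}) (\<lambda>x. haar I x * haar J x)"
    and "(LINT x|lebesgue_on {0..<1}. haar I x * haar J x) = (if I = J then measure lebesgue I else 0)"
proof -
  have "integrable (lebesgue_on {0..<1}) (\<lambda>x. haar I x * haar J x) \<and>
    (LINT x|lebesgue_on {0..<1}. haar I x * haar J x) = (if I = J then measure lebesgue I else 0)"
  proof (cases "I = J")
    case True
    obtain a b where ab: "I = {a..<b}" "0 \<le> a" "a < b" "b \<le> 1" using dyadic_Ico[OF assms(1)] .
    show ?thesis
      using integral_indicator_Ico_unit[of a b] ab haar_square[OF assms(1)] True by simp
  next
    case False
    then obtain K c where K: "K \<in> {I, J}" "\<And>x. haar I x * haar J x = c * haar K x"
      using haar_mult_distinct[OF assms] by blast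
    then have "K \<in> dyadic_intervals" using assms by auto
    then show ?thesis using False integral_haar[of K] by (simp add: K(2))
  qed
  then show "integrable (lebesgue_on {0..<1}) (\<lambda>x. haar I x * haar J x)"
    and "(LINT x|lebesgue_on {0..<1}. haar I x * haar J x) = (if I = J then measure lebesgue I else 0)"
    by auto
qed

lemma measure_dyadic_pos: "I \<in> dyadic_intervals \<Longrightarrow> 0 < measure lebesgue I"
  by (erule dyadic_Ico) auto

lemma haar_coeff_sum:
  assumes "finite A" "A \<subseteq> dyadic_intervals" "J \<in> dyadic_intervals"
  shows "haar_coeff (\<lambda>x. \<Sum>I\<in>A. a I * haar I x) J = (if J \<in> A then a J else 0)"
proof -
  have "(LINT x|lebesgue_on {0..<1}. (\<Sum>I\<in>A. a I * haar I x) * haar J x)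
      = (LINT x|lebesgue_on {0..<1}. (\<Sum>I\<in>A. a I * (haar I x * haar J x)))"
    by (simp add: sum_distrib_right mult.assoc)
  also have "\<dots> = (\<Sum>I\<in>A. a I * (LINT x|lebesgue_on {0..<1}. haar I x * haar J x))"
    by (subst Bochner_Integration.integral_sum) (use assms haar_orthogonal(1) in auto)
  also have "\<dots> = (\<Sum>I\<in>A. if I = J then a J * measure lebesgue J else 0)"
  proof (intro sum.cong refl)
    fix I assume "I \<in> A"
    then show "a I * (LINT x|lebesgue_on {0..<1}. haar I x * haar J x) = (if I = J then a J * measure lebesgue J else 0)"
      using haar_orthogonal(2)[of I J] assms by (cases "I = J") auto
  qed
  also have "\<dots> = (if J \<in> A then a J * measure lebesgue J else 0)"
    using assms(1) by simp
  finally show ?thesis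
    using measure_dyadic_pos[OF assms(3)] by (simp add: haar_coeff_def)
qed

lemma SL_norm_sum:
  assumes "finite A" "A \<subseteq> dyadic_intervals"
  shows "SL_norm (\<lambda>x. \<Sum>I\<in>A. a I * haar I x) =
    real_of_ereal (esssup (lebesgue_on {0..<1}) (\<lambda>x. ereal (sqrt (\<Sum>I\<in>A. (a I)\<^sup>2 * (haar I x)\<^sup>2))))"
proof -
  let ?f = "\<lambda>x. \<Sum>I\<in>A. a I * haar I x"
  have "square_function ?f x = ereal (sqrt (\<Sum>I\<in>A. (a I)\<^sup>2 * (haar I x)\<^sup>2))" for x
  proof -
    let ?g = "\<lambda>I. (haar_coeff ?f I)\<^sup>2 * (haar I x)\<^sup>2"
    have 0: "?g I = 0" if "I \<in> dyadic_intervals - A" for I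
      using that haar_coeff_sum[OF assms, of I a] by simp
    have "(?g has_sum (\<Sum>I\<in>A. ?g I)) A" using assms(1) by (rule has_sum_finite)
    have s: "(?g has_sum (\<Sum>I\<in>A. ?g I)) dyadic_intervals"
    proof (subst has_sum_cong_neutral)
      show "(?g has_sum (\<Sum>I\<in>A. ?g I)) A" by fact
    qed (use 0 assms(2) in blast)+
    have e: "(\<Sum>I\<in>A. ?g I) = (\<Sum>I\<in>A. (a I)\<^sup>2 * (haar I x)\<^sup>2)"
    proof (rule sum.cong[OF refl])
      fix I assume I: "I \<in> A"
      then have "haar_coeff ?f I = a I" using haar_coeff_sum[OF assms, of I a] assms(2) by auto
      then show "?g I = (a I)\<^sup>2 * (haar I x)\<^sup>2" by (rule arg_cong)
    qed
    show ?thesis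
      unfolding square_function_def if_P[OF has_sum_imp_summable[OF s]] infsumI[OF s] e ..
  qed
  then have "square_function ?f = (\<lambda>x. ereal (sqrt (\<Sum>I\<in>A. (a I)\<^sup>2 * (haar I x)\<^sup>2)))" by (rule ext)
  then show ?thesis by (simp only: SL_norm_def)
qed

lemma finite_dyadic_upto: "finite (dyadic_upto m)"
proof -
  have "dyadic_level k \<subseteq> (\<lambda>i::nat. {real i / 2 ^ k ..< (real i + 1) / 2 ^ k}) ` {..<2 ^ k}" for k
  proof
    fix I assume I: "I \<in> dyadic_level k"
    then have "I \<in> dyadic_intervals" and meas: "measure lebesgue I = 1 / 2 ^ k"
      by (auto simp: dyadic_level_def)
    then obtain m i where i: "I = {real i / 2 ^ m ..< (real i + 1) / 2 ^ m}" "i < 2 ^ m"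
      using dyadic_cases by metis
    then have "measure lebesgue I = 1 / 2 ^ m"
      by (simp add: divide_right_mono diff_divide_distrib[symmetric])
    with meas have "(2::real) ^ m = 2 ^ k" by simp
    then have "m = k" by simp
    with i show "I \<in> (\<lambda>i::nat. {real i / 2 ^ k ..< (real i + 1) / 2 ^ k}) ` {..<2 ^ k}" by blast
  qed
  then show ?thesis unfolding dyadic_upto_def by (meson finite_UN_I finite_atMost finite_imageI finite_lessThan finite_subset)
qed

lemma dyadic_upto_subset: "dyadic_upto m \<subseteq> dyadic_intervals"
  by (auto simp: dyadic_upto_def dyadic_level_def)

end

theory Submission
  imports Defs "HOL-Library.Sublist"
begin

text \<open>
  Below level \<open>m\<close> the dyadic tree consists of \<open>2\<^sup>m\<close> disjoint subtrees.  Colour an interval \<open>K\<close> by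
  whether the diagonal coefficient of \<open>T\<close> at \<open>h\<^sub>K\<close> is at least \<open>1/2\<close>.  A pigeonhole argument gives in each
  subtree a monochromatic copy \<open>I \<mapsto> \<phi>(u, I)\<close> of the tree of depth \<open>n\<close>, and the same colour for a set \<open>U\<close>
  of at least half of the \<open>u\<close>; the colour selects \<open>H = T\<close> or \<open>H = Id - T\<close>.  For signs \<open>\<epsilon>\<close>, the map
  \<open>h\<^sub>I \<mapsto> \<Sum>u\<in>U. \<epsilon>(u, I) h\<^bsub>\<phi>(u, I)\<^esub>\<close> and the averages \<open>f \<mapsto> |U|\<inverse> \<Sum>u\<in>U. \<epsilon>(u, I) f\<^bsub>\<phi>(u, I)\<^esub>\<close> are contractions,
  so \<open>H\<close> compresses to a matrix on the tree of depth \<open>n\<close>.  The rows of \<open>H\<close> are absolutely summable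
  over antichains with a bound independent of \<open>N\<close>.  Hence, for random signs, this matrix differs from the
  diagonal matrix of averages \<open>|U|\<inverse> \<Sum>u\<in>U. H\<^bsub>\<phi>(u, I), \<phi>(u, I)\<^esub>\<close> by an error whose entries have second
  moments \<open>O(1/|U|)\<close>.  For large \<open>m\<close> some choice of signs yields an almost diagonal matrix with diagonal at
  least \<open>1/2\<close>, whose inverse has norm at most \<open>2 + \<eta>\<close>.
\<close>

section \<open>Square-function norms on the binary tree\<close>

text \<open>
  Dyadic intervals are encoded as binary words, inclusion as the reversed prefix order, and points of
  \<open>[0, 1)\<close> as words of length \<open>n\<close>.
\<close>

definition words :: "nat \<Rightarrow> bool list set" where
  "words n = {w. length w \<le> n}"

text \<open>This is the norm of \<open>SL n\<close> in Haar coordinates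
  (\<open>SL_norm_synth\<close>): the square function is constant on the intervals coded by words
  \<open>x\<close> of length \<open>n\<close>, and the intervals containing such an interval are the
  prefixes of \<open>x\<close>.\<close>

definition path_norm :: "nat \<Rightarrow> (bool list \<Rightarrow> real) \<Rightarrow> real" where
  "path_norm n c = Max ((\<lambda>x. L2_set c {w. prefix w x}) ` {x. length x = n})"

definition matvec :: "'b set \<Rightarrow> ('a \<Rightarrow> 'b \<Rightarrow> real) \<Rightarrow> ('b \<Rightarrow> real) \<Rightarrow> 'a \<Rightarrow> real" where
  "matvec V A c w = (\<Sum>v\<in>V. A w v * c v)"

lemma finite_words [simp]: "finite (words n)"
  using finite_lists_length_le[of "UNIV :: bool set" n] by (simp add: words_def)

lemma Nil_in_words [simp]: "[] \<in> words n"
  by (simp add: words_def)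

lemma finite_length_eq [simp]: "finite {x :: bool list. length x = n}"
  using finite_lists_length_eq[of "UNIV :: bool set" n] by simp

lemma finite_prefixes [simp]: "finite {w. prefix w x}"
  by (metis List.finite_set set_prefixes_eq)

lemma prefixes_subset_words: "length x = n \<Longrightarrow> {w. prefix w x} \<subseteq> words n"
  by (auto simp: words_def dest: prefix_length_le)

lemma path_norm_ge: "length x = n \<Longrightarrow> L2_set c {w. prefix w x} \<le> path_norm n c"
  unfolding path_norm_def by (intro Max_ge) auto

lemma path_norm_le:
  assumes "\<And>x. length x = n \<Longrightarrow> L2_set c {w. prefix w x} \<le> K"
  shows "path_norm n c \<le> K"
proof -
  have "replicate n False \<in> {x. length x = n}" by simp
  then have "{x :: bool list. length x = n} \<noteq> {}" by blast
  then show ?thesis unfolding path_norm_def using assms by (subst Max_le_iff) auto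
qed

lemma path_norm_cong:
  assumes "\<And>w. w \<in> words n \<Longrightarrow> c w = d w"
  shows "path_norm n c = path_norm n d"
  unfolding path_norm_def
  by (intro arg_cong[of _ _ Max] image_cong refl L2_set_cong assms) (use prefixes_subset_words in auto)

lemma path_norm_nonneg: "0 \<le> path_norm n c"
  by (rule order_trans[OF L2_set_nonneg path_norm_ge[of "replicate n False"]]) simp

text \<open>The longest word of a finite chain has all others as prefixes; padding it with
  \<open>False\<close> gives a full branch.\<close>

lemma chain_common_extension:
  assumes V: "V \<subseteq> words n" and chain: "\<And>v w. v \<in> V \<Longrightarrow> w \<in> V \<Longrightarrow> prefix v w \<or> prefix w v"
  obtains y where "length y = n" "\<And>v. v \<in> V \<Longrightarrow> prefix v y"
proof (cases "V = {}")
  case True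
  then show ?thesis using that[of "replicate n False"] by simp
next
  case False
  have fin: "finite V" using V finite_subset finite_words by blast
  obtain v where v: "v \<in> V" "Max (length ` V) = length v"
    using Max_in[of "length ` V"] fin False by (metis finite_imageI image_iff image_is_empty)
  have len: "length w \<le> length v" if "w \<in> V" for w
    using Max_ge[of "length ` V" "length w"] fin that v by simp
  have pre: "prefix w v" if "w \<in> V" for w
    using chain[OF that v(1)] len[OF that] by (auto simp: prefix_def)
  show ?thesis
  proof (rule that[of "v @ replicate (n - length v) False"])
    show "length (v @ replicate (n - length v) False) = n" using v(1) V by (auto simp: words_def)
  qed (use pre in auto)
qed

lemma L2_set_chain_le:
  assumes "V \<subseteq> words n" "\<And>v w. v \<in> V \<Longrightarrow> w \<in> V \<Longrightarrow> prefix v w \<or> prefix w v"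
  shows "L2_set c V \<le> path_norm n c"
proof -
  obtain y where y: "length y = n" "\<And>v. v \<in> V \<Longrightarrow> prefix v y"
    using chain_common_extension[OF assms] by blast
  have "L2_set c V \<le> L2_set c {w. prefix w y}"
    unfolding L2_set_def by (intro real_sqrt_le_mono sum_mono2) (use y in auto)
  then show ?thesis using path_norm_ge[OF y(1), of c] by linarith
qed

lemma abs_le_path_norm: "w \<in> words n \<Longrightarrow> \<bar>c w\<bar> \<le> path_norm n c"
  using L2_set_chain_le[of "{w}" n c] by simp

lemma path_norm_triangle: "path_norm n (\<lambda>w. c w + d w) \<le> path_norm n c + path_norm n d"
proof (rule path_norm_le)
  fix x :: "bool list" assume x: "length x = n"
  have "L2_set (\<lambda>w. c w + d w) {w. prefix w x} \<le> L2_set c {w. prefix w x} + L2_set d {w. prefix w x}"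
    by (rule L2_set_triangle_ineq)
  then show "L2_set (\<lambda>w. c w + d w) {w. prefix w x} \<le> path_norm n c + path_norm n d"
    using path_norm_ge[OF x, of c] path_norm_ge[OF x, of d] by linarith
qed

lemma L2_set_mono_abs: "(\<And>i. i \<in> K \<Longrightarrow> \<bar>f i\<bar> \<le> \<bar>g i\<bar>) \<Longrightarrow> L2_set f K \<le> L2_set g K"
  unfolding L2_set_def by (intro real_sqrt_le_mono sum_mono) (simp add: abs_le_square_iff)

text \<open>The Haar system is 1-unconditional, because the square function depends only on absolute
  values of coefficients.\<close>

lemma path_norm_mono:
  assumes "\<And>w. w \<in> words n \<Longrightarrow> \<bar>c w\<bar> \<le> \<bar>d w\<bar>"
  shows "path_norm n c \<le> path_norm n d"
proof (rule path_norm_le)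
  fix x :: "bool list" assume x: "length x = n"
  have "L2_set c {w. prefix w x} \<le> L2_set d {w. prefix w x}"
    using assms prefixes_subset_words[OF x] by (intro L2_set_mono_abs) auto
  then show "L2_set c {w. prefix w x} \<le> path_norm n d" using path_norm_ge[OF x, of d] by linarith
qed

lemma path_norm_scale:
  assumes "0 \<le> k"
  shows "k * path_norm n c \<le> path_norm n (\<lambda>w. k * c w)"
proof (cases "k = 0")
  case True then show ?thesis by (simp add: path_norm_nonneg)
next
  case False
  then have k: "k > 0" using assms by simp
  have "path_norm n c \<le> path_norm n (\<lambda>w. k * c w) / k"
  proof (rule path_norm_le)
    fix x :: "bool list" assume x: "length x = n"
    show "L2_set c {w. prefix w x} \<le> path_norm n (\<lambda>w. k * c w) / k"
      using path_norm_ge[OF x, of "\<lambda>w. k * c w"] L2_set_right_distrib[OF assms, of c "{w. prefix w x}"] k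
      by (simp add: field_simps)
  qed
  then show ?thesis using k by (simp add: field_simps)
qed

text \<open>A crude l1 bound. Its loss depends on \<open>n\<close> alone, so small matrix entries
  can absorb it.\<close>

lemma path_norm_le_card:
  assumes "\<And>w. w \<in> words n \<Longrightarrow> \<bar>c w\<bar> \<le> b"
  shows "path_norm n c \<le> real (card (words n)) * b"
proof (rule path_norm_le)
  fix x :: "bool list" assume x: "length x = n"
  have "L2_set c {w. prefix w x} \<le> (\<Sum>w | prefix w x. \<bar>c w\<bar>)" by (rule L2_set_le_sum_abs)
  also have "\<dots> \<le> (\<Sum>w\<in>words n. \<bar>c w\<bar>)" by (intro sum_mono2) (use prefixes_subset_words[OF x] in auto)
  also have "\<dots> \<le> real (card (words n)) * b" using sum_bounded_above[of "words n" "\<lambda>w. \<bar>c w\<bar>" b] assms by simp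
  finally show "L2_set c {w. prefix w x} \<le> real (card (words n)) * b" .
qed

lemma matvec_compose:
  assumes "finite V" "finite W"
  shows "matvec V A (matvec W B c) x = matvec W (\<lambda>x w. matvec V A (\<lambda>v. B v w) x) c x"
  unfolding matvec_def
  by (simp add: sum_distrib_left sum_distrib_right mult.assoc) (rule sum.swap)

text \<open>An antichain supports sign patterns of norm at most \<open>1\<close>; test against the signs of the row.\<close>

lemma row_sum_antichain_le:
  assumes norm: "\<And>c. path_norm N (matvec (words N) h c) \<le> B * path_norm N c" and "0 \<le> B"
    and w: "w \<in> words N" and V: "V \<subseteq> words N"
    and anti: "\<And>v v'. v \<in> V \<Longrightarrow> v' \<in> V \<Longrightarrow> prefix v v' \<Longrightarrow> v = v'"
  shows "(\<Sum>v\<in>V. \<bar>h w v\<bar>) \<le> B"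
proof -
  define c where "c v = (if v \<in> V then sgn (h w v) else 0)" for v
  have "path_norm N c \<le> 1"
  proof (rule path_norm_le)
    fix x :: "bool list" assume x: "length x = N"
    let ?P = "{u. prefix u x}"
    have "(\<Sum>u\<in>?P. (c u)\<^sup>2) = (\<Sum>u\<in>?P \<inter> V. (c u)\<^sup>2)"
      by (intro sum.mono_neutral_right) (auto simp: c_def)
    also have "\<dots> \<le> (\<Sum>u\<in>?P \<inter> V. 1)"
      by (intro sum_mono) (auto simp: c_def sgn_real_def)
    also have "card (?P \<inter> V) \<le> Suc 0"
    proof (subst card_le_Suc0_iff_eq)
      show "\<forall>a\<in>?P \<inter> V. \<forall>b\<in>?P \<inter> V. a = b" using anti prefix_same_cases by blast
    qed simp
    then have "(\<Sum>u\<in>?P \<inter> V. 1) \<le> (1::real)" by simp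
    finally show "L2_set c ?P \<le> 1" by (simp add: L2_set_def)
  qed
  then have "B * path_norm N c \<le> B" using \<open>0 \<le> B\<close> mult_left_mono by fastforce
  have "(\<Sum>v\<in>V. \<bar>h w v\<bar>) = (\<Sum>v\<in>V. h w v * c v)"
    by (intro sum.cong) (auto simp: c_def sgn_real_def)
  also have "\<dots> = matvec (words N) h c w"
    unfolding matvec_def using V by (intro sum.mono_neutral_left) (auto simp: c_def)
  also have "\<dots> \<le> path_norm N (matvec (words N) h c)"
    using abs_le_path_norm[OF w, of "matvec (words N) h c"] by linarith
  also have "\<dots> \<le> B * path_norm N c" by (rule norm)
  finally show ?thesis using \<open>B * path_norm N c \<le> B\<close> by linarith
qed

section \<open>Monochromatic subtrees\<close>

text \<open>Strict inequalities count levels, so that \<open>k = 0\<close> is the empty tree, where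
  the induction below can start. The order is reflected as well as preserved, which keeps
  incomparable words incomparable.\<close>

definition tree_embedding :: "nat \<Rightarrow> nat \<Rightarrow> (bool list \<Rightarrow> bool list) \<Rightarrow> bool" where
  "tree_embedding k l \<phi> \<longleftrightarrow> (\<forall>v. length v < k \<longrightarrow> length (\<phi> v) < l) \<and>
     (\<forall>v w. length v < k \<longrightarrow> length w < k \<longrightarrow> (prefix (\<phi> v) (\<phi> w) \<longleftrightarrow> prefix v w))"

text \<open>Ramsey argument by induction on the total number of levels. The root supplies one level
  of its own colour \<open>b0\<close>, so both subtrees below it are asked for one level fewer of
  that colour. If one of them answers with the other colour, its copy suffices; if both answer with
  \<open>b0\<close>, they are joined under the root.\<close>

lemma monochromatic_embedding:
  fixes k :: "bool \<Rightarrow> nat" and col :: "bool list \<Rightarrow> bool"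
  shows "\<exists>b \<phi>. tree_embedding (k b) (k True + k False) \<phi> \<and> (\<forall>v. length v < k b \<longrightarrow> col (\<phi> v) = b)"
proof (induction "k True + k False" arbitrary: k col)
  case 0
  then show ?case by (intro exI[of _ True] exI[of _ id]) (simp add: tree_embedding_def)
next
  case (Suc s)
  define b0 where "b0 = col []"
  show ?case
  proof (cases "k b0 = 0")
    \<comment> \<open>No level of colour \<open>b0\<close> is requested, so the empty copy satisfies
      all conditions vacuously.\<close>
    case True
    then show ?thesis by (intro exI[of _ b0] exI[of _ id]) (simp add: tree_embedding_def)
  next
    case False
    define k' where "k' = k(b0 := k b0 - 1)"
    have s: "s = k' True + k' False" using Suc.hyps(2) False by (cases b0) (auto simp: k'_def)
    have "\<exists>b \<phi>. tree_embedding (k' b) s \<phi> \<and> (\<forall>v. length v < k' b \<longrightarrow> col (a # \<phi> v) = b)" for a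
      using Suc.hyps(1)[OF s, of "\<lambda>w. col (a # w)"] s by simp
    then obtain b \<phi> where emb: "tree_embedding (k' (b a)) s (\<phi> a)"
      and col: "\<And>v. length v < k' (b a) \<Longrightarrow> col (a # \<phi> a v) = b a" for a by metis
    show ?thesis
    proof (cases "\<forall>a. b a = b0")
      case False
      then obtain a where a: "b a \<noteq> b0" by blast
      then have k: "k' (b a) = k (b a)" by (simp add: k'_def)
      show ?thesis
        by (rule exI[of _ "b a"], rule exI[of _ "\<lambda>v. a # \<phi> a v"])
          (use emb[of a] col[of _ a] Suc.hyps(2) in \<open>auto simp: tree_embedding_def k\<close>)
    next
      case True
      define \<psi> where "\<psi> v = (case v of [] \<Rightarrow> [] | a # v' \<Rightarrow> a # \<phi> a v')" for v
      have k: "length v' < k' (b a)" if "length (a # v') < k b0" for a v'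
        using that True by (simp add: k'_def)
      have "length (\<psi> v) < Suc s \<and> col (\<psi> v) = b0" if "length v < k b0" for v
        using emb col[of _ "hd v"] k that True
        by (cases v) (auto simp: \<psi>_def tree_embedding_def b0_def)
      moreover have "prefix (\<psi> v) (\<psi> w) \<longleftrightarrow> prefix v w" if "length v < k b0" "length w < k b0" for v w
        using emb k that by (cases v; cases w) (auto simp: \<psi>_def tree_embedding_def)
      ultimately show ?thesis
        using Suc.hyps(2) by (intro exI[of _ b0] exI[of _ \<psi>]) (auto simp: tree_embedding_def)
    qed
  qed
qed

section \<open>Random signs\<close>

text \<open>Sign patterns on a set are coded by its subsets, so that expectations over signs become
  sums over \<open>Pow A\<close>.\<close>

definition set_sign :: "'a set \<Rightarrow> 'a \<Rightarrow> real" where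
  "set_sign B p = (if p \<in> B then 1 else -1)"

lemma sum_Pow_insert:
  assumes "finite A" "r \<notin> A"
  shows "(\<Sum>B\<in>Pow (insert r A). f B) = (\<Sum>B\<in>Pow A. f B + f (insert r B))"
proof -
  have "inj_on (insert r) (Pow A)" using assms(2) by (auto simp: inj_on_def)
  moreover have "Pow A \<inter> insert r ` Pow A = {}" using assms(2) by auto
  ultimately show ?thesis
    using assms(1) by (simp add: Pow_insert sum.union_disjoint sum.reindex sum.distrib)
qed

lemma sum_sign_cong:
  assumes "r \<notin> A" "B \<subseteq> A"
  shows "(\<Sum>p\<in>A. set_sign (insert r B) p * x p) = (\<Sum>p\<in>A. set_sign B p * x p)"
  by (intro sum.cong) (use assms in \<open>auto simp: set_sign_def\<close>)

text \<open>Second moment of a Rademacher sum. For a new index the two signs are paired and the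
  cross terms cancel: (L - x)^2 + (L + x)^2 = 2 L^2 + 2 x^2.\<close>

lemma sum_signs_linear:
  assumes "finite A"
  shows "(\<Sum>B\<in>Pow A. (\<Sum>p\<in>A. set_sign B p * x p)\<^sup>2) = 2 ^ card A * (\<Sum>p\<in>A. (x p)\<^sup>2)"
  using assms
proof (induction A)
  case (insert r A)
  let ?L = "\<lambda>B. \<Sum>p\<in>A. set_sign B p * x p"
  have "(\<Sum>p\<in>insert r A. set_sign B p * x p)\<^sup>2 + (\<Sum>p\<in>insert r A. set_sign (insert r B) p * x p)\<^sup>2
      = 2 * (?L B)\<^sup>2 + 2 * (x r)\<^sup>2" if "B \<in> Pow A" for B
  proof -
    have "set_sign B r = -1" "set_sign (insert r B) r = 1" using that insert.hyps by (auto simp: set_sign_def)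
    moreover have "?L (insert r B) = ?L B" using insert.hyps that by (simp add: sum_sign_cong)
    ultimately show ?thesis
      unfolding sum.insert[OF insert.hyps] by (simp only:) (simp add: power2_eq_square algebra_simps)
  qed
  then have "(\<Sum>B\<in>Pow (insert r A). (\<Sum>p\<in>insert r A. set_sign B p * x p)\<^sup>2)
      = (\<Sum>B\<in>Pow A. 2 * (?L B)\<^sup>2 + 2 * (x r)\<^sup>2)"
    using insert.hyps by (subst sum_Pow_insert) (auto intro: sum.cong)
  then show ?case
    using insert by (simp add: sum.distrib sum_distrib_left[symmetric] card_Pow algebra_simps)
qed simp

text \<open>Second moment of a Rademacher chaos of order two. As the diagonal vanishes, a new index
  \<open>r\<close> adds its sign times the linear form \<open>?L\<close>, and pairing the two signs
  again removes the cross term. The factor 2 pays for the asymmetry of \<open>\<tau>\<close>,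
  through (a + b)^2 \<le> 2 a^2 + 2 b^2.\<close>

lemma sum_signs_quadratic:
  assumes "finite A" "\<And>p. p \<in> A \<Longrightarrow> \<tau> p p = 0"
  shows "(\<Sum>B\<in>Pow A. (\<Sum>p\<in>A. \<Sum>q\<in>A. set_sign B p * set_sign B q * \<tau> p q)\<^sup>2)
    \<le> 2 * 2 ^ card A * (\<Sum>p\<in>A. \<Sum>q\<in>A. (\<tau> p q)\<^sup>2)"
  using assms
proof (induction A)
  case (insert r A)
  let ?Q = "\<lambda>C B. \<Sum>p\<in>C. \<Sum>q\<in>C. set_sign B p * set_sign B q * \<tau> p q"
  let ?L = "\<lambda>B. \<Sum>p\<in>A. set_sign B p * (\<tau> p r + \<tau> r p)"
  have Q: "?Q (insert r A) B = ?Q A B + set_sign B r * ?L B" for B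
    using insert by (simp add: sum.distrib sum_distrib_left algebra_simps)
  have "(?Q (insert r A) B)\<^sup>2 + (?Q (insert r A) (insert r B))\<^sup>2 = 2 * (?Q A B)\<^sup>2 + 2 * (?L B)\<^sup>2"
    if "B \<in> Pow A" for B
  proof -
    have s: "set_sign B r = -1" "set_sign (insert r B) r = 1" using that insert.hyps by (auto simp: set_sign_def)
    have L: "?L (insert r B) = ?L B" using insert.hyps that by (simp add: sum_sign_cong)
    have "?Q A (insert r B) = ?Q A B"
      by (intro sum.cong refl) (use insert.hyps that in \<open>auto simp: set_sign_def\<close>)
    then show ?thesis unfolding Q s L by (simp add: power2_eq_square algebra_simps)
  qed
  then have "(\<Sum>B\<in>Pow (insert r A). (?Q (insert r A) B)\<^sup>2) = (\<Sum>B\<in>Pow A. 2 * (?Q A B)\<^sup>2 + 2 * (?L B)\<^sup>2)"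
    using insert.hyps by (subst sum_Pow_insert) (auto intro: sum.cong)
  also have "\<dots> = 2 * (\<Sum>B\<in>Pow A. (?Q A B)\<^sup>2) + 2 * (2 ^ card A * (\<Sum>p\<in>A. (\<tau> p r + \<tau> r p)\<^sup>2))"
    by (subst sum_signs_linear[OF insert.hyps(1), symmetric]) (simp add: sum.distrib sum_distrib_left)
  also have "\<dots> \<le> 2 * (2 * 2 ^ card A * (\<Sum>p\<in>A. \<Sum>q\<in>A. (\<tau> p q)\<^sup>2))
      + 2 * (2 ^ card A * (\<Sum>p\<in>A. 2 * (\<tau> p r)\<^sup>2 + 2 * (\<tau> r p)\<^sup>2))"
  proof (intro add_mono mult_left_mono sum_mono)
    show "(\<Sum>B\<in>Pow A. (?Q A B)\<^sup>2) \<le> 2 * 2 ^ card A * (\<Sum>p\<in>A. \<Sum>q\<in>A. (\<tau> p q)\<^sup>2)"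
      using insert by simp
    show "(\<tau> p r + \<tau> r p)\<^sup>2 \<le> 2 * (\<tau> p r)\<^sup>2 + 2 * (\<tau> r p)\<^sup>2" for p
      using sum_squares_bound[of "\<tau> p r" "\<tau> r p"] by (simp add: power2_sum)
  qed auto
  also have "\<dots> = 2 * 2 ^ card (insert r A) * (\<Sum>p\<in>insert r A. \<Sum>q\<in>insert r A. (\<tau> p q)\<^sup>2)"
    using insert by (simp add: sum.distrib sum_distrib_left algebra_simps)
  finally show ?case .
qed simp

text \<open>Some pattern does no worse than the average. Summing over \<open>S\<close> before
  choosing yields one pattern that serves all forms at once.\<close>

lemma exists_signs:
  assumes "finite A" "finite S" "\<And>s p. s \<in> S \<Longrightarrow> p \<in> A \<Longrightarrow> \<tau> s p p = 0"
  obtains \<epsilon> :: "'a \<Rightarrow> real" where "\<And>p. \<epsilon> p \<in> {1, -1}"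
    "(\<Sum>s\<in>S. (\<Sum>p\<in>A. \<Sum>q\<in>A. \<epsilon> p * \<epsilon> q * \<tau> s p q)\<^sup>2) \<le> 2 * (\<Sum>s\<in>S. \<Sum>p\<in>A. \<Sum>q\<in>A. (\<tau> s p q)\<^sup>2)"
proof -
  let ?Q = "\<lambda>B. \<Sum>s\<in>S. (\<Sum>p\<in>A. \<Sum>q\<in>A. set_sign B p * set_sign B q * \<tau> s p q)\<^sup>2"
  let ?K = "2 * (\<Sum>s\<in>S. \<Sum>p\<in>A. \<Sum>q\<in>A. (\<tau> s p q)\<^sup>2)"
  have "(\<Sum>B\<in>Pow A. ?Q B) = (\<Sum>s\<in>S. \<Sum>B\<in>Pow A. (\<Sum>p\<in>A. \<Sum>q\<in>A. set_sign B p * set_sign B q * \<tau> s p q)\<^sup>2)"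
    by (rule sum.swap)
  also have "\<dots> \<le> (\<Sum>s\<in>S. 2 * 2 ^ card A * (\<Sum>p\<in>A. \<Sum>q\<in>A. (\<tau> s p q)\<^sup>2))"
    by (intro sum_mono sum_signs_quadratic assms)
  also have "\<dots> = (\<Sum>B\<in>Pow A. ?K)"
    using assms(1) by (simp add: sum_distrib_left card_Pow algebra_simps)
  finally have le: "(\<Sum>B\<in>Pow A. ?Q B) \<le> (\<Sum>B\<in>Pow A. ?K)" .
  have "\<exists>B\<in>Pow A. ?Q B \<le> ?K"
  proof (rule ccontr)
    assume no: "\<not> (\<exists>B\<in>Pow A. ?Q B \<le> ?K)"
    have "?K < ?Q B" if "B \<in> Pow A" for B using no that not_le by blast
    then have "(\<Sum>B\<in>Pow A. ?K) < (\<Sum>B\<in>Pow A. ?Q B)"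
      using assms(1) by (intro sum_strict_mono) auto
    then show False using le by linarith
  qed
  then obtain B where "?Q B \<le> ?K" by blast
  then show ?thesis by (intro that[of "set_sign B"]) (auto simp: set_sign_def)
qed

section \<open>Almost diagonal matrices\<close>

text \<open>Neumann series: \<open>u k\<close> is (-F)^k applied to \<open>g\<close>, and it decays
  geometrically in the maximum norm because the row sums of \<open>F\<close> are at most
  \<open>\<theta>\<close>.\<close>

lemma neumann_solvable:
  fixes F :: "'a \<Rightarrow> 'a \<Rightarrow> real"
  assumes G: "finite G" and F: "\<And>j. j \<in> G \<Longrightarrow> (\<Sum>i\<in>G. \<bar>F j i\<bar>) \<le> \<theta>" and \<theta>: "0 \<le> \<theta>" "\<theta> < 1"
  shows "\<exists>a. \<forall>j\<in>G. a j + (\<Sum>i\<in>G. F j i * a i) = g j"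
proof -
  define u where "u = rec_nat g (\<lambda>k v j. - (\<Sum>i\<in>G. F j i * v i))"
  have u0: "u 0 j = g j" and uS: "u (Suc k) j = - (\<Sum>i\<in>G. F j i * u k i)" for k j
    by (simp_all add: u_def)
  define C where "C = (\<Sum>j\<in>G. \<bar>g j\<bar>)"
  have bound: "\<bar>u k j\<bar> \<le> C * \<theta> ^ k" if "j \<in> G" for k j
    using that
  proof (induction k arbitrary: j)
    case 0
    then show ?case using G using member_le_sum[of j G "\<lambda>j. \<bar>g j\<bar>"] by (simp add: u0 C_def)
  next
    case (Suc k)
    have C: "0 \<le> C" by (simp add: C_def sum_nonneg)
    have "\<bar>u (Suc k) j\<bar> \<le> (\<Sum>i\<in>G. \<bar>F j i\<bar> * \<bar>u k i\<bar>)"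
      using sum_abs[of "\<lambda>i. F j i * u k i" G] by (simp add: uS abs_mult)
    also have "\<dots> \<le> (\<Sum>i\<in>G. \<bar>F j i\<bar> * (C * \<theta> ^ k))"
      by (intro sum_mono mult_left_mono Suc.IH) auto
    also have "\<dots> \<le> \<theta> * (C * \<theta> ^ k)"
      unfolding sum_distrib_right[symmetric]
      by (intro mult_right_mono F Suc.prems) (use C \<theta> in auto)
    finally show ?case by (simp add: algebra_simps)
  qed
  have sm: "summable (\<lambda>k. u k j)" if "j \<in> G" for j
  proof (rule summable_comparison_test')
    show "summable (\<lambda>k. C * \<theta> ^ k)" using \<theta> by (intro summable_mult summable_geometric) auto
    show "norm (u k j) \<le> C * \<theta> ^ k" for k using bound[OF that] by simp
  qed
  have "suminf (\<lambda>k. u k j) + (\<Sum>i\<in>G. F j i * suminf (\<lambda>k. u k i)) = g j" if j: "j \<in> G" for j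
  proof -
    have "(\<Sum>i\<in>G. F j i * suminf (\<lambda>k. u k i)) = (\<Sum>i\<in>G. suminf (\<lambda>k. F j i * u k i))"
      by (intro sum.cong refl) (simp add: suminf_mult sm)
    also have "\<dots> = (\<Sum>k. \<Sum>i\<in>G. F j i * u k i)"
      by (rule suminf_sum[symmetric]) (intro summable_mult sm)
    also have "(\<lambda>k. \<Sum>i\<in>G. F j i * u k i) = (\<lambda>k. - u (Suc k) j)" by (simp add: uS)
    also have "(\<Sum>k. - u (Suc k) j) = - (\<Sum>k. u (Suc k) j)"
      by (rule suminf_minus) (use sm[OF j] summable_Suc_iff[of "\<lambda>k. u k j"] in simp)
    finally show ?thesis using suminf_split_head[OF sm[OF j]] by (simp add: u0)
  qed
  then show ?thesis by (intro exI[of _ "\<lambda>j. suminf (\<lambda>k. u k j)"]) blast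
qed

text \<open>Half the norm of \<open>a\<close> is at most the norm of \<open>A a\<close> plus that of
  \<open>E a\<close>, and the latter is at most (1/2 - 1/\<kappa>) times the norm of
  \<open>a\<close>. This lower estimate bounds the inverse by \<kappa>; a Neumann series shows that
  the inverse exists.\<close>

lemma almost_diagonal_inverse:
  fixes A E :: "bool list \<Rightarrow> bool list \<Rightarrow> real"
  assumes A: "\<And>J I. J \<in> words n \<Longrightarrow> I \<in> words n \<Longrightarrow> A J I = (if J = I then d J else 0) + E J I"
    and d: "\<And>J. J \<in> words n \<Longrightarrow> 1 / 2 \<le> d J"
    and E: "\<And>J I. J \<in> words n \<Longrightarrow> I \<in> words n \<Longrightarrow> \<bar>E J I\<bar> \<le> \<delta>"
    and \<delta>: "\<delta> * (real (card (words n)))\<^sup>2 \<le> 1 / 2 - 1 / \<kappa>" and \<kappa>: "0 < \<kappa>"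
  shows "\<exists>X. (\<forall>f. path_norm n (matvec (words n) X f) \<le> \<kappa> * path_norm n f) \<and>
    (\<forall>a. \<forall>J\<in>words n. matvec (words n) X (matvec (words n) A a) J = a J)"
proof -
  let ?W = "words n" let ?g = "real (card (words n))"
  have "0 \<le> \<bar>E [] []\<bar>" by simp
  then have \<delta>0: "0 \<le> \<delta>" using E[of "[]" "[]"] by (simp del: abs_ge_zero)
  have g1: "1 \<le> ?g"
    using card_gt_0_iff[of ?W] Nil_in_words[of n] finite_words[of n] by (metis One_nat_def Suc_leI empty_iff of_nat_1 of_nat_le_iff)
  have Aa: "matvec ?W A a J = d J * a J + matvec ?W E a J" if "J \<in> ?W" for a J
  proof -
    have "matvec ?W A a J = (\<Sum>I\<in>?W. (if J = I then d J * a J else 0) + E J I * a I)"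
      unfolding matvec_def by (intro sum.cong refl) (auto simp: A that algebra_simps)
    then show ?thesis using that by (simp add: sum.distrib matvec_def)
  qed
  have lower: "path_norm n a \<le> \<kappa> * path_norm n (matvec ?W A a)" for a
  proof -
    have Ea: "\<bar>matvec ?W E a J\<bar> \<le> ?g * (\<delta> * path_norm n a)" if "J \<in> ?W" for J
    proof -
      have "\<bar>matvec ?W E a J\<bar> \<le> (\<Sum>I\<in>?W. \<bar>E J I\<bar> * \<bar>a I\<bar>)"
        using sum_abs[of "\<lambda>I. E J I * a I" ?W] by (simp add: matvec_def abs_mult)
      also have "\<dots> \<le> (\<Sum>I\<in>?W. \<delta> * path_norm n a)"
        by (intro sum_mono mult_mono E that abs_le_path_norm) (use \<delta>0 in auto)
      finally show ?thesis by simp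
    qed
    have "1 / 2 * path_norm n a \<le> path_norm n (\<lambda>J. 1 / 2 * a J)" by (intro path_norm_scale) simp
    also have "\<dots> \<le> path_norm n (\<lambda>J. d J * a J)"
    proof (rule path_norm_mono)
      fix w assume "w \<in> ?W"
      then have "1 / 2 * \<bar>a w\<bar> \<le> \<bar>d w\<bar> * \<bar>a w\<bar>" using d[of w] by (intro mult_right_mono) auto
      then show "\<bar>1 / 2 * a w\<bar> \<le> \<bar>d w * a w\<bar>" by (simp add: abs_mult)
    qed
    also have "\<dots> = path_norm n (\<lambda>J. matvec ?W A a J + - matvec ?W E a J)"
      by (rule path_norm_cong) (simp add: Aa)
    also have "\<dots> \<le> path_norm n (matvec ?W A a) + path_norm n (\<lambda>J. - matvec ?W E a J)"
      by (rule path_norm_triangle)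
    \<comment> \<open>One factor \<open>?g\<close> comes from the row sums of \<open>E\<close>, the
      other from passing from coordinates to the path norm; hence the square in the condition on
      \<delta>.\<close>
    also have "path_norm n (\<lambda>J. - matvec ?W E a J) \<le> ?g * (?g * (\<delta> * path_norm n a))"
      by (rule path_norm_le_card) (simp add: Ea)
    also have "\<dots> \<le> (1 / 2 - 1 / \<kappa>) * path_norm n a"
      using mult_right_mono[OF \<delta> path_norm_nonneg[of n a]] by (simp add: power2_eq_square algebra_simps)
    finally show ?thesis using \<kappa> by (simp add: field_simps)
  qed
  have solvable: "\<exists>a. \<forall>J\<in>?W. matvec ?W A a J = f J" for f
  proof -
    \<comment> \<open>Dividing row \<open>J\<close> by \<open>d J\<close> leaves the identity plus a
      perturbation with row sums at most 1 - 2/\<kappa>.\<close>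
    have "\<exists>a. \<forall>J\<in>?W. a J + (\<Sum>I\<in>?W. E J I / d J * a I) = f J / d J"
    proof (rule neumann_solvable)
      fix J assume J: "J \<in> ?W"
      have "(\<Sum>I\<in>?W. \<bar>E J I / d J\<bar>) \<le> (\<Sum>I\<in>?W. 2 * \<delta>)"
      proof (rule sum_mono)
        fix I assume "I \<in> ?W"
        then have "\<bar>E J I\<bar> \<le> \<delta> * 1" "\<delta> * 1 \<le> \<delta> * (2 * d J)"
          using E[OF J, of I] d[OF J] \<delta>0 mult_left_mono[of 1 "2 * d J" \<delta>] by auto
        then show "\<bar>E J I / d J\<bar> \<le> 2 * \<delta>" using d[OF J] by (simp add: abs_divide field_simps)
      qed
      also have "\<dots> = 2 * (\<delta> * (?g * 1))" by simp
      also have "\<dots> \<le> 2 * (\<delta> * (?g * ?g))"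
        by (intro mult_left_mono g1) (use \<delta>0 in auto)
      also have "\<dots> \<le> 1 - 2 / \<kappa>" using \<delta> by (simp add: power2_eq_square)
      finally show "(\<Sum>I\<in>?W. \<bar>E J I / d J\<bar>) \<le> 1 - 2 / \<kappa>" .
    next
      show "1 - 2 / \<kappa> < 1" using \<kappa> by simp
    next
      have "0 \<le> \<delta> * ?g\<^sup>2" using \<delta>0 by simp
      then show "0 \<le> 1 - 2 / \<kappa>" using \<delta> by simp
    qed simp
    then obtain a where a: "\<And>J. J \<in> ?W \<Longrightarrow> a J + (\<Sum>I\<in>?W. E J I / d J * a I) = f J / d J" by blast
    have "matvec ?W A a J = f J" if J: "J \<in> ?W" for J
    proof -
      have "a J + matvec ?W E a J / d J = f J / d J"
        using a[OF J] by (simp add: matvec_def sum_divide_distrib)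
      then show ?thesis using d[OF J] Aa[OF J, of a] by (simp add: field_simps)
    qed
    then show ?thesis by blast
  qed
  \<comment> \<open>Solving for the unit vectors gives the columns of a right inverse
    \<open>X\<close>.\<close>
  have "\<forall>K. \<exists>a. \<forall>J\<in>?W. matvec ?W A a J = (if J = K then 1 else 0)" by (intro allI solvable)
  then obtain Y where Y: "\<And>K J. J \<in> ?W \<Longrightarrow> matvec ?W A (Y K) J = (if J = K then 1 else 0)" by metis
  define X where "X J K = Y K J" for J K
  have AX: "matvec ?W A (matvec ?W X f) J = f J" if "J \<in> ?W" for f J
  proof -
    have "matvec ?W A (matvec ?W X f) J = (\<Sum>K\<in>?W. matvec ?W A (Y K) J * f K)"
      by (simp add: matvec_compose) (simp add: matvec_def X_def)
    also have "\<dots> = (\<Sum>K\<in>?W. if J = K then f J else 0)"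
      by (intro sum.cong) (auto simp: Y that)
    finally show ?thesis using that by simp
  qed
  have "path_norm n (matvec ?W X f) \<le> \<kappa> * path_norm n f" for f
    using lower[of "matvec ?W X f"] path_norm_cong[of n "matvec ?W A (matvec ?W X f)" f, OF AX] by simp
  moreover have "matvec ?W X (matvec ?W A a) J = a J" if J: "J \<in> ?W" for a J
  proof -
    \<comment> \<open>\<open>A\<close> annihilates \<open>?b\<close> since \<open>X\<close> is a
      right inverse, and the lower estimate forces \<open>?b\<close> to vanish; so \<open>X\<close>
      is also a left inverse.\<close>
    let ?b = "\<lambda>J. matvec ?W X (matvec ?W A a) J - a J"
    have "matvec ?W A ?b K = 0" if "K \<in> ?W" for K
    proof -
      have "matvec ?W A ?b K = matvec ?W A (matvec ?W X (matvec ?W A a)) K - matvec ?W A a K"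
        by (simp add: matvec_def[of ?W A] sum_subtractf right_diff_distrib)
      then show ?thesis using AX[OF that] by simp
    qed
    then have "path_norm n (matvec ?W A ?b) = path_norm n (\<lambda>_. 0)" by (rule path_norm_cong)
    also have "\<dots> \<le> 0" using path_norm_le_card[of n "\<lambda>_. 0" 0] by simp
    finally have "\<kappa> * path_norm n (matvec ?W A ?b) \<le> 0" using \<kappa> by (simp add: mult_nonneg_nonpos)
    then have "path_norm n ?b \<le> 0" using lower[of ?b] by linarith
    then show ?thesis using abs_le_path_norm[OF J, of ?b] by simp
  qed
  ultimately show ?thesis by blast
qed

section \<open>Factorization through disjoint copies of a tree\<close>

text \<open>Copies with different \<open>u\<close> are incomparable, so a branch of the large tree
  meets at most one copy.\<close>

locale tree_copies =
  fixes n N :: nat and U :: "'u set" and \<phi> :: "'u \<times> bool list \<Rightarrow> bool list"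
  assumes finite_U: "finite U" and U_nonempty: "U \<noteq> {}"
    and prefix_iff: "\<lbrakk>u \<in> U; v \<in> words n; u' \<in> U; v' \<in> words n\<rbrakk> \<Longrightarrow>
      prefix (\<phi> (u, v)) (\<phi> (u', v')) \<longleftrightarrow> u = u' \<and> prefix v v'"
    and in_words: "\<lbrakk>u \<in> U; v \<in> words n\<rbrakk> \<Longrightarrow> \<phi> (u, v) \<in> words N"
begin

text \<open>Matrix of the map sending the Haar function at \<open>v\<close> to the signed sum of
  those at \<open>\<phi> (u, v)\<close>; its rows are indexed by the large tree.\<close>

definition embed :: "('u \<times> bool list \<Rightarrow> real) \<Rightarrow> bool list \<Rightarrow> bool list \<Rightarrow> real" where
  "embed \<epsilon> w v = (\<Sum>u\<in>U. if \<phi> (u, v) = w then \<epsilon> (u, v) else 0)"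

text \<open>The transpose of \<open>embed\<close> over the number of copies, that is, the signed
  averaging map.\<close>

definition project :: "('u \<times> bool list \<Rightarrow> real) \<Rightarrow> bool list \<Rightarrow> bool list \<Rightarrow> real" where
  "project \<epsilon> v w = embed \<epsilon> w v / real (card U)"

text \<open>The matrix product of \<open>project\<close>, \<open>h\<close> and \<open>embed\<close>,
  written out; see \<open>project_matvec_embed\<close>.\<close>

definition compress ::
  "('u \<times> bool list \<Rightarrow> real) \<Rightarrow> (bool list \<Rightarrow> bool list \<Rightarrow> real) \<Rightarrow> bool list \<Rightarrow> bool list \<Rightarrow> real" where
  "compress \<epsilon> h J I =
    (\<Sum>u\<in>U. \<Sum>u'\<in>U. \<epsilon> (u, J) * \<epsilon> (u', I) * h (\<phi> (u, J)) (\<phi> (u', I))) / real (card U)"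

lemma card_U_pos: "0 < real (card U)"
  using finite_U U_nonempty by (simp add: card_gt_0_iff)

lemma \<phi>_eq_iff:
  "\<lbrakk>u \<in> U; v \<in> words n; u' \<in> U; v' \<in> words n\<rbrakk> \<Longrightarrow> \<phi> (u, v) = \<phi> (u', v') \<longleftrightarrow> u = u' \<and> v = v'"
  using prefix_iff[of u v u' v'] prefix_iff[of u' v' u v] by auto

lemma inj_on_\<phi>: "inj_on \<phi> (U \<times> words n)"
  by (auto simp: inj_on_def \<phi>_eq_iff)

lemma matvec_embed:
  assumes "u \<in> U" "v \<in> words n"
  shows "matvec (words n) (embed \<epsilon>) a (\<phi> (u, v)) = \<epsilon> (u, v) * a v"
proof -
  have "embed \<epsilon> (\<phi> (u, v)) v' = (if v' = v then \<epsilon> (u, v) else 0)" if "v' \<in> words n" for v'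
  proof -
    have "embed \<epsilon> (\<phi> (u, v)) v' = (\<Sum>u'\<in>U. if u' = u then (if v' = v then \<epsilon> (u, v) else 0) else 0)"
      unfolding embed_def by (intro sum.cong refl) (use assms that in \<open>auto simp: \<phi>_eq_iff\<close>)
    then show ?thesis using assms finite_U by simp
  qed
  then have "matvec (words n) (embed \<epsilon>) a (\<phi> (u, v))
      = (\<Sum>v'\<in>words n. if v' = v then \<epsilon> (u, v) * a v else 0)"
    unfolding matvec_def by (intro sum.cong) auto
  then show ?thesis using assms by simp
qed

lemma matvec_embed_outside:
  assumes "w \<notin> \<phi> ` (U \<times> words n)"
  shows "matvec (words n) (embed \<epsilon>) a w = 0"
  unfolding matvec_def embed_def
  by (intro sum.neutral ballI) (use assms in \<open>auto intro!: sum.neutral\<close>)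

lemma matvec_project:
  assumes "J \<in> words n"
  shows "matvec (words N) (project \<epsilon>) c J = (\<Sum>u\<in>U. \<epsilon> (u, J) * c (\<phi> (u, J))) / real (card U)"
proof -
  have "(\<Sum>w\<in>words N. embed \<epsilon> w J * c w)
      = (\<Sum>u\<in>U. \<Sum>w\<in>words N. if \<phi> (u, J) = w then \<epsilon> (u, J) * c w else 0)"
    unfolding embed_def sum_distrib_right by (subst sum.swap) (intro sum.cong, auto)
  also have "\<dots> = (\<Sum>u\<in>U. \<epsilon> (u, J) * c (\<phi> (u, J)))"
    by (intro sum.cong refl) (simp add: in_words assms)
  finally show ?thesis
    by (simp add: matvec_def project_def flip: sum_divide_distrib)
qed

text \<open>A branch of the large tree meets the image in a chain inside one copy. Its preimage is a
  chain of the small tree with the same coefficients up to sign.\<close>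

lemma path_norm_embed:
  assumes \<epsilon>: "\<And>p. \<epsilon> p \<in> {1, -1}"
  shows "path_norm N (matvec (words n) (embed \<epsilon>) a) \<le> path_norm n a"
proof (rule path_norm_le)
  fix x :: "bool list" assume x: "length x = N"
  let ?m = "matvec (words n) (embed \<epsilon>) a"
  define Q where "Q = {p \<in> U \<times> words n. prefix (\<phi> p) x}"
  have comparable: "fst p = fst q \<and> (prefix (snd p) (snd q) \<or> prefix (snd q) (snd p))"
    if "p \<in> Q" "q \<in> Q" for p q
  proof -
    obtain u v u' v' where p: "p = (u, v)" "q = (u', v')" by (meson surj_pair)
    then have "u \<in> U" "v \<in> words n" "u' \<in> U" "v' \<in> words n" and "prefix (\<phi> p) x" "prefix (\<phi> q) x"
      using that by (auto simp: Q_def)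
    moreover then have "prefix (\<phi> p) (\<phi> q) \<or> prefix (\<phi> q) (\<phi> p)" by (intro prefix_same_cases)
    ultimately show ?thesis
      unfolding p using prefix_iff[of u v u' v'] prefix_iff[of u' v' u v] by auto
  qed
  have "(\<Sum>w | prefix w x. (?m w)\<^sup>2) = (\<Sum>w\<in>\<phi> ` Q. (?m w)\<^sup>2)"
    by (intro sum.mono_neutral_right) (auto simp: Q_def intro!: matvec_embed_outside)
  also have "\<dots> = (\<Sum>p\<in>Q. (?m (\<phi> p))\<^sup>2)"
    using inj_on_subset[OF inj_on_\<phi>, of Q] by (subst sum.reindex) (auto simp: Q_def)
  also have "\<dots> = (\<Sum>p\<in>Q. (a (snd p))\<^sup>2)"
  proof (intro sum.cong refl)
    fix p assume "p \<in> Q"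
    then show "(?m (\<phi> p))\<^sup>2 = (a (snd p))\<^sup>2"
      using \<epsilon>[of p] by (cases p) (auto simp: Q_def matvec_embed)
  qed
  also have "\<dots> = (\<Sum>v\<in>snd ` Q. (a v)\<^sup>2)"
  proof -
    have "inj_on snd Q" by (intro inj_onI prod_eqI) (use comparable in blast)+
    then show ?thesis by (simp add: sum.reindex)
  qed
  finally have "L2_set ?m {w. prefix w x} = L2_set a (snd ` Q)" by (simp add: L2_set_def)
  also have "\<dots> \<le> path_norm n a"
  proof (rule L2_set_chain_le)
    show "snd ` Q \<subseteq> words n" by (auto simp: Q_def)
    show "prefix v w \<or> prefix w v" if "v \<in> snd ` Q" "w \<in> snd ` Q" for v w
      using that comparable by blast
  qed
  finally show "L2_set ?m {w. prefix w x} \<le> path_norm n a" .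
qed

text \<open>By Cauchy-Schwarz the square of an average is at most the average of the squares. For
  fixed \<open>u\<close> the image of a branch is a chain, which contributes at most the squared
  norm of \<open>c\<close>.\<close>

lemma path_norm_project:
  assumes \<epsilon>: "\<And>p. \<epsilon> p \<in> {1, -1}"
  shows "path_norm n (matvec (words N) (project \<epsilon>) c) \<le> path_norm N c"
proof (rule path_norm_le)
  fix y :: "bool list" assume y: "length y = n"
  let ?M = "real (card U)" and ?P = "{J. prefix J y}" and ?b = "matvec (words N) (project \<epsilon>) c"
  have P: "?P \<subseteq> words n" using prefixes_subset_words[OF y] .
  have "(?b J)\<^sup>2 \<le> (\<Sum>u\<in>U. (c (\<phi> (u, J)))\<^sup>2) / ?M" if "J \<in> ?P" for J
  proof -
    have "(\<Sum>u\<in>U. \<epsilon> (u, J) * c (\<phi> (u, J)))\<^sup>2 \<le> (\<Sum>u\<in>U. (\<epsilon> (u, J) * c (\<phi> (u, J)))\<^sup>2) * ?M"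
      by (rule sum_squared_le_sum_of_squares)
    also have "(\<Sum>u\<in>U. (\<epsilon> (u, J) * c (\<phi> (u, J)))\<^sup>2) = (\<Sum>u\<in>U. (c (\<phi> (u, J)))\<^sup>2)"
    proof (intro sum.cong refl)
      show "(\<epsilon> (u, J) * c (\<phi> (u, J)))\<^sup>2 = (c (\<phi> (u, J)))\<^sup>2" for u using \<epsilon>[of "(u, J)"] by auto
    qed
    finally show ?thesis
      using card_U_pos that P by (simp add: matvec_project subset_iff power_divide power2_eq_square field_simps)
  qed
  then have "(\<Sum>J\<in>?P. (?b J)\<^sup>2) \<le> (\<Sum>J\<in>?P. (\<Sum>u\<in>U. (c (\<phi> (u, J)))\<^sup>2) / ?M)" by (rule sum_mono)
  also have "\<dots> = (\<Sum>u\<in>U. \<Sum>J\<in>?P. (c (\<phi> (u, J)))\<^sup>2) / ?M"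
    unfolding sum_divide_distrib[symmetric] by (subst sum.swap) simp
  also have "\<dots> \<le> (\<Sum>u\<in>U. (path_norm N c)\<^sup>2) / ?M"
  proof (intro divide_right_mono sum_mono)
    fix u assume u: "u \<in> U"
    have "inj_on (\<lambda>J. \<phi> (u, J)) ?P" by (intro inj_onI) (use u P \<phi>_eq_iff in blast)
    then have "sqrt (\<Sum>J\<in>?P. (c (\<phi> (u, J)))\<^sup>2) = L2_set c ((\<lambda>J. \<phi> (u, J)) ` ?P)"
      by (simp add: L2_set_def sum.reindex)
    also have "\<dots> \<le> path_norm N c"
    proof (rule L2_set_chain_le)
      show "(\<lambda>J. \<phi> (u, J)) ` ?P \<subseteq> words N" using u P in_words by auto
      show "prefix v w \<or> prefix w v" if "v \<in> (\<lambda>J. \<phi> (u, J)) ` ?P" "w \<in> (\<lambda>J. \<phi> (u, J)) ` ?P" for v w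
      proof -
        obtain J I where "J \<in> ?P" "I \<in> ?P" "v = \<phi> (u, J)" "w = \<phi> (u, I)" using \<open>v \<in> _\<close> \<open>w \<in> _\<close> by blast
        then show ?thesis
          using u P prefix_iff[of u J u I] prefix_iff[of u I u J] prefix_same_cases[of J y I] by auto
      qed
    qed
    finally show "(\<Sum>J\<in>?P. (c (\<phi> (u, J)))\<^sup>2) \<le> (path_norm N c)\<^sup>2" by (rule sqrt_le_D)
  qed simp
  also have "\<dots> = (path_norm N c)\<^sup>2" using card_U_pos by simp
  finally show "L2_set ?b ?P \<le> path_norm N c"
    unfolding L2_set_def by (rule real_le_lsqrt[OF path_norm_nonneg])
qed

lemma project_matvec_embed:
  assumes J: "J \<in> words n"
  shows "matvec (words N) (project \<epsilon>) (matvec (words N) h (matvec (words n) (embed \<epsilon>) a)) J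
    = matvec (words n) (compress \<epsilon> h) a J"
proof -
  let ?m = "matvec (words n) (embed \<epsilon>) a"
  have h: "matvec (words N) h ?m w = (\<Sum>u'\<in>U. \<Sum>I\<in>words n. h w (\<phi> (u', I)) * (\<epsilon> (u', I) * a I))" for w
  proof -
    have "matvec (words N) h ?m w = (\<Sum>w'\<in>\<phi> ` (U \<times> words n). h w w' * ?m w')"
      unfolding matvec_def[of "words N"]
      by (intro sum.mono_neutral_right) (auto simp: in_words intro!: matvec_embed_outside)
    also have "\<dots> = (\<Sum>p\<in>U \<times> words n. h w (\<phi> p) * ?m (\<phi> p))"
      using inj_on_\<phi> by (simp add: sum.reindex)
    also have "\<dots> = (\<Sum>p\<in>U \<times> words n. h w (\<phi> p) * (\<epsilon> p * a (snd p)))"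
      by (intro sum.cong refl) (auto simp: matvec_embed)
    finally show ?thesis by (simp add: sum.cartesian_product case_prod_unfold)
  qed
  have "(\<Sum>u\<in>U. \<epsilon> (u, J) * matvec (words N) h ?m (\<phi> (u, J)))
      = (\<Sum>u\<in>U. \<Sum>u'\<in>U. \<Sum>I\<in>words n. \<epsilon> (u, J) * \<epsilon> (u', I) * h (\<phi> (u, J)) (\<phi> (u', I)) * a I)"
    by (simp add: h sum_distrib_left algebra_simps)
  also have "\<dots> = (\<Sum>u\<in>U. \<Sum>I\<in>words n. \<Sum>u'\<in>U. \<epsilon> (u, J) * \<epsilon> (u', I) * h (\<phi> (u, J)) (\<phi> (u', I)) * a I)"
    by (intro sum.cong refl sum.swap)
  also have "\<dots> = (\<Sum>I\<in>words n. \<Sum>u\<in>U. \<Sum>u'\<in>U. \<epsilon> (u, J) * \<epsilon> (u', I) * h (\<phi> (u, J)) (\<phi> (u', I)) * a I)"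
    by (rule sum.swap)
  finally show ?thesis
    unfolding matvec_project[OF J]
    by (simp add: matvec_def[of "words n"] compress_def sum_distrib_right sum_divide_distrib)
qed

text \<open>Signs are indexed by all pairs of a copy and a word, whereas the entry at (J, I)
  involves only the pairs over \<open>J\<close> and over \<open>I\<close>. This translates between
  the two forms of the sum.\<close>

lemma sum_pairs_at:
  assumes "J \<in> words n" "I \<in> words n"
  shows "(\<Sum>p\<in>U \<times> words n. \<Sum>q\<in>U \<times> words n. if snd p = J \<and> snd q = I then F p q else 0)
    = (\<Sum>u\<in>U. \<Sum>u'\<in>U. F (u, J) (u', I))"
proof -
  have *: "(\<Sum>p\<in>U \<times> words n. if snd p = K then G p else 0) = (\<Sum>u\<in>U. G (u, K))"
    if "K \<in> words n" for K and G :: "'u \<times> bool list \<Rightarrow> 'c::comm_monoid_add"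
  proof -
    have "(\<Sum>p\<in>U \<times> words n. if snd p = K then G p else 0)
        = (\<Sum>u\<in>U. \<Sum>v\<in>words n. if v = K then G (u, K) else 0)"
      by (subst sum.cartesian_product) (intro sum.cong, auto)
    then show ?thesis using that by simp
  qed
  have "(\<Sum>q\<in>U \<times> words n. if snd p = J \<and> snd q = I then F p q else 0)
      = (if snd p = J then \<Sum>q\<in>U \<times> words n. if snd q = I then F p q else 0 else 0)" for p
    by simp
  then show ?thesis by (simp add: * assms del: sum.delta sum.delta')
qed

text \<open>For fixed \<open>I\<close> the words \<open>\<phi> (u, I)\<close> form an antichain, so
  their row sum is at most \<open>B\<close>, and l2 is dominated by l1. The bound does not grow with
  the number of copies.\<close>

lemma block_square_sum_le:
  assumes norm: "\<And>c. path_norm N (matvec (words N) h c) \<le> B * path_norm N c" and "0 \<le> B"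
    and w: "w \<in> words N" and I: "I \<in> words n"
  shows "(\<Sum>u\<in>U. (h w (\<phi> (u, I)))\<^sup>2) \<le> B\<^sup>2"
proof -
  have inj: "inj_on (\<lambda>u. \<phi> (u, I)) U" using I by (auto simp: inj_on_def \<phi>_eq_iff)
  have "L2_set (\<lambda>u. h w (\<phi> (u, I))) U \<le> (\<Sum>u\<in>U. \<bar>h w (\<phi> (u, I))\<bar>)" by (rule L2_set_le_sum_abs)
  also have "\<dots> = (\<Sum>v\<in>(\<lambda>u. \<phi> (u, I)) ` U. \<bar>h w v\<bar>)" using inj by (simp add: sum.reindex)
  also have "\<dots> \<le> B"
    by (rule row_sum_antichain_le[OF norm \<open>0 \<le> B\<close> w]) (use I in \<open>auto simp: in_words prefix_iff\<close>)
  finally show ?thesis unfolding L2_set_def by (rule sqrt_le_D)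
qed

text \<open>Terms with \<open>p = q\<close> carry the sign 1 and give the averaged diagonal. The
  others form a chaos whose coefficients in each block have square sum at most |U| B^2; after
  division by |U|^2 this is small when there are many copies.\<close>

lemma exists_almost_diagonal_signs:
  assumes norm: "\<And>c. path_norm N (matvec (words N) h c) \<le> B * path_norm N c" and "0 \<le> B"
    and large: "2 * (real (card (words n)))\<^sup>2 * B\<^sup>2 \<le> \<delta>\<^sup>2 * real (card U)" and \<delta>: "0 \<le> \<delta>"
  obtains \<epsilon> E where "\<And>p. \<epsilon> p \<in> {1, -1}"
    "\<And>J I. J \<in> words n \<Longrightarrow> I \<in> words n \<Longrightarrow> compress \<epsilon> h J I =
       (if J = I then (\<Sum>u\<in>U. h (\<phi> (u, J)) (\<phi> (u, J))) / real (card U) else 0) + E J I"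
    "\<And>J I. J \<in> words n \<Longrightarrow> I \<in> words n \<Longrightarrow> \<bar>E J I\<bar> \<le> \<delta>"
proof -
  let ?W = "words n" and ?P = "U \<times> words n" and ?M = "real (card U)" and ?g = "real (card (words n))"
  \<comment> \<open>The index \<open>s\<close> is a matrix position. Zeroing \<open>p = q\<close>
    supplies the vanishing diagonal that \<open>exists_signs\<close> asks for.\<close>
  define \<tau> where "\<tau> s p q = (if snd p = fst s \<and> snd q = snd s then if p = q then 0 else h (\<phi> p) (\<phi> q) else 0)" for s p q
  obtain \<epsilon> :: "'u \<times> bool list \<Rightarrow> real" where \<epsilon>: "\<And>p. \<epsilon> p \<in> {1, -1}"
    and le: "(\<Sum>s\<in>?W \<times> ?W. (\<Sum>p\<in>?P. \<Sum>q\<in>?P. \<epsilon> p * \<epsilon> q * \<tau> s p q)\<^sup>2)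
      \<le> 2 * (\<Sum>s\<in>?W \<times> ?W. \<Sum>p\<in>?P. \<Sum>q\<in>?P. (\<tau> s p q)\<^sup>2)"
    by (rule exists_signs[of ?P "?W \<times> ?W" \<tau>]) (auto simp: finite_U \<tau>_def)
  define E where "E J I = (\<Sum>p\<in>?P. \<Sum>q\<in>?P. \<epsilon> p * \<epsilon> q * \<tau> (J, I) p q) / ?M" for J I
  have \<epsilon>2: "\<epsilon> p * \<epsilon> p = 1" for p using \<epsilon>[of p] by auto
  have "(\<Sum>s\<in>?W \<times> ?W. \<Sum>p\<in>?P. \<Sum>q\<in>?P. (\<tau> s p q)\<^sup>2) \<le> (\<Sum>s\<in>?W \<times> ?W. ?M * B\<^sup>2)"
  proof (rule sum_mono, clarify)
    fix J I assume JI: "J \<in> ?W" "I \<in> ?W"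
    have "(\<Sum>p\<in>?P. \<Sum>q\<in>?P. (\<tau> (J, I) p q)\<^sup>2)
        \<le> (\<Sum>p\<in>?P. \<Sum>q\<in>?P. if snd p = J \<and> snd q = I then (h (\<phi> p) (\<phi> q))\<^sup>2 else 0)"
      by (intro sum_mono) (auto simp: \<tau>_def)
    also have "\<dots> = (\<Sum>u\<in>U. \<Sum>u'\<in>U. (h (\<phi> (u, J)) (\<phi> (u', I)))\<^sup>2)" by (rule sum_pairs_at[OF JI])
    also have "\<dots> \<le> (\<Sum>u\<in>U. B\<^sup>2)"
      by (intro sum_mono block_square_sum_le norm \<open>0 \<le> B\<close> in_words JI)
    finally show "(\<Sum>p\<in>?P. \<Sum>q\<in>?P. (\<tau> (J, I) p q)\<^sup>2) \<le> ?M * B\<^sup>2" by simp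
  qed
  also have "\<dots> = ?g\<^sup>2 * ?M * B\<^sup>2" by (simp add: card_cartesian_product power2_eq_square)
  finally have total: "(\<Sum>s\<in>?W \<times> ?W. (\<Sum>p\<in>?P. \<Sum>q\<in>?P. \<epsilon> p * \<epsilon> q * \<tau> s p q)\<^sup>2) \<le> 2 * ?g\<^sup>2 * B\<^sup>2 * ?M"
    using le by (simp add: algebra_simps)
  have E: "\<bar>E J I\<bar> \<le> \<delta>" if "J \<in> ?W" "I \<in> ?W" for J I
  proof -
    have "(E J I * ?M)\<^sup>2 = (\<Sum>p\<in>?P. \<Sum>q\<in>?P. \<epsilon> p * \<epsilon> q * \<tau> (J, I) p q)\<^sup>2"
      using card_U_pos by (simp add: E_def)
    \<comment> \<open>A single entry is dominated by the total over all positions, so one choice of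
      signs controls every entry.\<close>
    also have "\<dots> \<le> (\<Sum>s\<in>?W \<times> ?W. (\<Sum>p\<in>?P. \<Sum>q\<in>?P. \<epsilon> p * \<epsilon> q * \<tau> s p q)\<^sup>2)"
      by (rule member_le_sum[of "(J, I)" _ "\<lambda>s. (\<Sum>p\<in>?P. \<Sum>q\<in>?P. \<epsilon> p * \<epsilon> q * \<tau> s p q)\<^sup>2"]) (use that in auto)
    also have "\<dots> \<le> 2 * ?g\<^sup>2 * B\<^sup>2 * ?M" by (rule total)
    also have "\<dots> \<le> \<delta>\<^sup>2 * ?M * ?M" by (intro mult_right_mono large) simp
    also have "\<dots> = (\<delta> * ?M)\<^sup>2" by (simp add: power2_eq_square)
    finally have "\<bar>E J I * ?M\<bar> \<le> \<bar>\<delta> * ?M\<bar>" by (simp only: abs_le_square_iff)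
    then show ?thesis using card_U_pos \<delta> by (simp add: abs_mult)
  qed
  have split: "compress \<epsilon> h J I = (if J = I then (\<Sum>u\<in>U. h (\<phi> (u, J)) (\<phi> (u, J))) / ?M else 0) + E J I"
    if JI: "J \<in> ?W" "I \<in> ?W" for J I
  proof -
    let ?h = "\<lambda>u u'. \<epsilon> (u, J) * \<epsilon> (u', I) * h (\<phi> (u, J)) (\<phi> (u', I))"
    have "(\<Sum>p\<in>?P. \<Sum>q\<in>?P. \<epsilon> p * \<epsilon> q * \<tau> (J, I) p q)
        = (\<Sum>p\<in>?P. \<Sum>q\<in>?P. if snd p = J \<and> snd q = I then if p = q then 0 else \<epsilon> p * \<epsilon> q * h (\<phi> p) (\<phi> q) else 0)"
      by (intro sum.cong refl) (simp add: \<tau>_def)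
    also have "\<dots> = (\<Sum>u\<in>U. \<Sum>u'\<in>U. if (u, J) = (u', I) then 0 else ?h u u')" by (rule sum_pairs_at[OF JI])
    finally have off: "(\<Sum>u\<in>U. \<Sum>u'\<in>U. if (u, J) = (u', I) then 0 else ?h u u') = E J I * ?M"
      using card_U_pos by (simp add: E_def)
    have "(\<Sum>u\<in>U. \<Sum>u'\<in>U. ?h u u') = (\<Sum>u\<in>U. \<Sum>u'\<in>U. (if u' = u then if J = I then h (\<phi> (u, J)) (\<phi> (u, J)) else 0 else 0)
        + (if (u, J) = (u', I) then 0 else ?h u u'))"
      by (intro sum.cong refl) (auto simp: \<epsilon>2)
    also have "\<dots> = (\<Sum>u\<in>U. if J = I then h (\<phi> (u, J)) (\<phi> (u, J)) else 0) + E J I * ?M"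
      unfolding sum.distrib off using finite_U by simp
    finally show ?thesis using card_U_pos by (auto simp: compress_def add_divide_distrib)
  qed
  show ?thesis by (rule that[of \<epsilon> E, OF \<epsilon> split E])
qed

text \<open>Take \<open>embed\<close> for \<rho>, and for \<sigma> the map \<open>project\<close>
  followed by the inverse of the compressed matrix. Both copy maps are contractions, so only the
  inverse costs the factor \<kappa>.\<close>

lemma matrix_factorization:
  assumes norm: "\<And>c. path_norm N (matvec (words N) h c) \<le> B * path_norm N c" and "0 \<le> B"
    and diag: "\<And>u v. u \<in> U \<Longrightarrow> v \<in> words n \<Longrightarrow> 1 / 2 \<le> h (\<phi> (u, v)) (\<phi> (u, v))"
    and \<delta>: "0 \<le> \<delta>" "\<delta> * (real (card (words n)))\<^sup>2 \<le> 1 / 2 - 1 / \<kappa>" and \<kappa>: "0 < \<kappa>"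
    and large: "2 * (real (card (words n)))\<^sup>2 * B\<^sup>2 \<le> \<delta>\<^sup>2 * real (card U)"
  shows "\<exists>\<rho> \<sigma>. (\<forall>a. path_norm N (matvec (words n) \<rho> a) \<le> path_norm n a) \<and>
    (\<forall>c. path_norm n (matvec (words N) \<sigma> c) \<le> \<kappa> * path_norm N c) \<and>
    (\<forall>a. \<forall>J\<in>words n. matvec (words N) \<sigma> (matvec (words N) h (matvec (words n) \<rho> a)) J = a J)"
proof -
  let ?W = "words n" and ?M = "real (card U)"
  obtain \<epsilon> E where \<epsilon>: "\<And>p. \<epsilon> p \<in> {1, -1}"
    and A: "\<And>J I. J \<in> ?W \<Longrightarrow> I \<in> ?W \<Longrightarrow> compress \<epsilon> h J I =
       (if J = I then (\<Sum>u\<in>U. h (\<phi> (u, J)) (\<phi> (u, J))) / ?M else 0) + E J I"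
    and E: "\<And>J I. J \<in> ?W \<Longrightarrow> I \<in> ?W \<Longrightarrow> \<bar>E J I\<bar> \<le> \<delta>"
    using exists_almost_diagonal_signs[OF norm \<open>0 \<le> B\<close> large \<delta>(1)] by blast
  have d: "1 / 2 \<le> (\<Sum>u\<in>U. h (\<phi> (u, J)) (\<phi> (u, J))) / ?M" if "J \<in> ?W" for J
    using sum_bounded_below[of U "1 / 2" "\<lambda>u. h (\<phi> (u, J)) (\<phi> (u, J))"] diag that card_U_pos
    by (simp add: field_simps)
  obtain X where X: "\<And>f. path_norm n (matvec ?W X f) \<le> \<kappa> * path_norm n f"
    and inv: "\<And>a J. J \<in> ?W \<Longrightarrow> matvec ?W X (matvec ?W (compress \<epsilon> h) a) J = a J"
    using almost_diagonal_inverse[OF A d E \<delta>(2) \<kappa>] by blast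
  define \<sigma> where "\<sigma> J w = matvec ?W X (\<lambda>K. project \<epsilon> K w) J" for J w
  have \<sigma>: "matvec (words N) \<sigma> c J = matvec ?W X (matvec (words N) (project \<epsilon>) c) J" for c J
    by (subst matvec_compose) (simp_all add: matvec_def \<sigma>_def)
  have "path_norm n (matvec (words N) \<sigma> c) \<le> \<kappa> * path_norm N c" for c
  proof -
    have "path_norm n (matvec (words N) \<sigma> c) \<le> \<kappa> * path_norm n (matvec (words N) (project \<epsilon>) c)"
      using X[of "matvec (words N) (project \<epsilon>) c"] path_norm_cong[of n "matvec (words N) \<sigma> c"] \<sigma> by simp
    also have "\<dots> \<le> \<kappa> * path_norm N c"
      using path_norm_project[of \<epsilon> c, OF \<epsilon>] \<kappa> by (intro mult_left_mono) auto
    finally show ?thesis .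
  qed
  moreover have "matvec (words N) \<sigma> (matvec (words N) h (matvec ?W (embed \<epsilon>) a)) J = a J" if J: "J \<in> ?W" for a J
  proof -
    have "matvec (words N) \<sigma> (matvec (words N) h (matvec ?W (embed \<epsilon>) a)) J
        = matvec ?W X (matvec ?W (compress \<epsilon> h) a) J"
      unfolding \<sigma> matvec_def[of ?W X] by (intro sum.cong refl) (simp add: project_matvec_embed)
    then show ?thesis using inv[OF J] by simp
  qed
  ultimately show ?thesis
    using path_norm_embed[of \<epsilon>, OF \<epsilon>]
    by (intro exI[of _ "embed \<epsilon>"] exI[of _ \<sigma>] conjI allI ballI)
qed

end

section \<open>Choice of the parameters and of the copies\<close>

proposition path_norm_factorization:
  fixes n :: nat and \<Gamma> \<eta> :: real
  assumes "0 < \<Gamma>" "0 < \<eta>"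
  shows "\<exists>N. \<forall>t. (\<forall>c. path_norm N (matvec (words N) t c) \<le> \<Gamma> * path_norm N c) \<longrightarrow>
    (\<exists>\<rho> \<sigma>. \<exists>h\<in>{t, \<lambda>w v. of_bool (w = v) - t w v}.
      (\<forall>a. path_norm N (matvec (words n) \<rho> a) \<le> path_norm n a) \<and>
      (\<forall>c. path_norm n (matvec (words N) \<sigma> c) \<le> (2 + \<eta>) * path_norm N c) \<and>
      (\<forall>a. \<forall>J\<in>words n. matvec (words N) \<sigma> (matvec (words N) h (matvec (words n) \<rho> a)) J = a J))"
proof -
  define g where "g = real (card (words n))"
  \<comment> \<open>The largest entrywise error that \<open>almost_diagonal_inverse\<close>
    tolerates for \<kappa> = 2 + \<eta>.\<close>
  define \<delta> where "\<delta> = (1 / 2 - 1 / (2 + \<eta>)) / g\<^sup>2"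
  have g: "0 < g"
    using card_gt_0_iff[of "words n"] Nil_in_words[of n] unfolding g_def by (metis empty_iff finite_words of_nat_0_less_iff)
  have "0 < 1 / 2 - 1 / (2 + \<eta>)" using assms by (simp add: field_simps)
  then have \<delta>: "0 < \<delta>" "\<delta> * g\<^sup>2 = 1 / 2 - 1 / (2 + \<eta>)" using g by (simp_all add: \<delta>_def)
  \<comment> \<open>This bounds both \<open>T\<close> and \<open>Id - T\<close>, as the choice
    between them comes later.\<close>
  define B where "B = \<Gamma> + 1"
  \<comment> \<open>The extra factor 2 allows for keeping only half of the 2^m copies.\<close>
  obtain m where m: "2 * g\<^sup>2 * B\<^sup>2 / \<delta>\<^sup>2 * 2 < 2 ^ m"
    using real_arch_pow[of 2] by auto
  \<comment> \<open>The first \<open>m\<close> letters select a subtree; its 2n + 2 levels are the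
    words of length at most 2n + 1.\<close>
  define N where "N = m + (2 * n + 1)"
  define leaves where "leaves = {u :: bool list. length u = m}"
  have card_leaves: "card leaves = 2 ^ m"
    using card_lists_length_eq[of "UNIV :: bool set" m] by (simp add: leaves_def)
  show ?thesis
  proof (intro exI[of _ N] allI impI)
    fix t :: "bool list \<Rightarrow> bool list \<Rightarrow> real"
    assume t: "\<forall>c. path_norm N (matvec (words N) t c) \<le> \<Gamma> * path_norm N c"
    define h where "h b = (if b then t else (\<lambda>w v. of_bool (w = v) - t w v))" for b
    have norm: "path_norm N (matvec (words N) (h b) c) \<le> B * path_norm N c" for b c
    proof (cases b)
      case True
      then show ?thesis using t[rule_format, of c] path_norm_nonneg[of N c] by (simp add: h_def B_def algebra_simps)
    next
      case False
      have "path_norm N (matvec (words N) (h b) c) = path_norm N (\<lambda>w. c w + - matvec (words N) t c w)"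
      proof (rule path_norm_cong)
        fix w assume "w \<in> words N"
        then have "(\<Sum>v\<in>words N. of_bool (w = v) * c v) = c w"
          by (simp add: of_bool_def if_distrib[of "\<lambda>x. x * _"] cong: if_cong)
        then show "matvec (words N) (h b) c w = c w + - matvec (words N) t c w"
          using False by (simp add: h_def matvec_def left_diff_distrib sum_subtractf)
      qed
      also have "\<dots> \<le> path_norm N c + path_norm N (\<lambda>w. - matvec (words N) t c w)"
        by (rule path_norm_triangle)
      also have "path_norm N (\<lambda>w. - matvec (words N) t c w) \<le> path_norm N (matvec (words N) t c)"
        by (rule path_norm_mono) simp
      finally show ?thesis using t[rule_format, of c] by (simp add: B_def algebra_simps)
    qed
    \<comment> \<open>Depth \<open>n\<close> means n + 1 levels, requested in either colour.\<close>
    have "\<exists>b \<psi>. tree_embedding (Suc n) (2 * n + 2) \<psi> \<and>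
        (\<forall>v. length v < Suc n \<longrightarrow> (1 / 2 \<le> t (u @ \<psi> v) (u @ \<psi> v)) = b)" for u
      using monochromatic_embedding[of "\<lambda>_. Suc n" "\<lambda>w. 1 / 2 \<le> t (u @ w) (u @ w)"] by (simp add: mult_2)
    then obtain col \<psi> where emb: "\<And>u. tree_embedding (Suc n) (2 * n + 2) (\<psi> u)"
      and col: "\<And>u v. length v < Suc n \<Longrightarrow> (1 / 2 \<le> t (u @ \<psi> u v) (u @ \<psi> u v)) = col u" by metis
    define U where "U b = {u \<in> leaves. col u = b}" for b
    have fin: "finite (U b)" for b by (simp add: U_def leaves_def)
    have "leaves = U True \<union> U False" "U True \<inter> U False = {}" by (auto simp: U_def)
    then have sum: "card (U True) + card (U False) = 2 ^ m"
      using card_Un_disjoint[OF fin fin] card_leaves by metis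
    obtain b where "2 ^ m \<le> 2 * card (U b)"
      using sum by (metis add_le_mono le_cases mult_2)
    then have b: "2 ^ m \<le> 2 * real (card (U b))" by (metis of_nat_le_iff of_nat_mult of_nat_numeral of_nat_power)
    define \<phi> where "\<phi> p = (case p of (u, v) \<Rightarrow> u @ \<psi> u v)" for p :: "bool list \<times> bool list"
    interpret tree_copies n N "U b" \<phi>
    proof
      show "finite (U b)" by (rule fin)
      have "(0::real) < 2 ^ m" by simp
      then have "real (card (U b)) \<noteq> 0" using b by linarith
      then show "U b \<noteq> {}" by auto
      show "prefix (\<phi> (u, v)) (\<phi> (u', v')) \<longleftrightarrow> u = u' \<and> prefix v v'"
        if "u \<in> U b" "v \<in> words n" "u' \<in> U b" "v' \<in> words n" for u v u' v'
      proof (cases "u = u'")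
        case True
        then show ?thesis
          using emb[of u] that by (simp add: \<phi>_def words_def tree_embedding_def less_Suc_eq_le)
      next
        case False
        \<comment> \<open>Distinct words of equal length \<open>m\<close> stay incomparable under
          any extension.\<close>
        then have "\<not> prefix (u @ x) (u' @ y)" for x y
          using that by (auto simp: U_def leaves_def prefix_def append_eq_append_conv)
        then show ?thesis using False by (simp add: \<phi>_def)
      qed
      show "\<phi> (u, v) \<in> words N" if "u \<in> U b" "v \<in> words n" for u v
      proof -
        have "length (\<psi> u v) < 2 * n + 2"
          using emb[of u] that(2) by (simp add: tree_embedding_def words_def less_Suc_eq_le)
        then show ?thesis using that(1) by (simp add: \<phi>_def U_def leaves_def words_def N_def)
      qed
    qed
    have large: "2 * (real (card (words n)))\<^sup>2 * B\<^sup>2 \<le> \<delta>\<^sup>2 * real (card (U b))"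
    proof -
      have "2 * g\<^sup>2 * B\<^sup>2 / \<delta>\<^sup>2 \<le> real (card (U b))" using m b by linarith
      then have "2 * g\<^sup>2 * B\<^sup>2 \<le> real (card (U b)) * \<delta>\<^sup>2" using \<delta>(1) by (subst (asm) pos_divide_le_eq) auto
      then show ?thesis by (simp add: g_def mult.commute)
    qed
    \<comment> \<open>Colour \<open>False\<close> means that the diagonal entry of \<open>t\<close>
      is below 1/2, so that of \<open>Id - t\<close> exceeds 1/2.\<close>
    have diag: "1 / 2 \<le> h b (\<phi> (u, v)) (\<phi> (u, v))" if "u \<in> U b" "v \<in> words n" for u v
      using col[of v u] that by (auto simp: h_def \<phi>_def U_def words_def less_Suc_eq_le not_le)
    have h: "h b \<in> {t, \<lambda>w v. of_bool (w = v) - t w v}" by (simp add: h_def)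
    have params: "0 \<le> B" "0 \<le> \<delta>" "0 < 2 + \<eta>" "\<delta> * (real (card (words n)))\<^sup>2 \<le> 1 / 2 - 1 / (2 + \<eta>)"
      using assms \<delta> by (simp_all add: B_def g_def)
    obtain \<rho> \<sigma> where "\<forall>a. path_norm N (matvec (words n) \<rho> a) \<le> path_norm n a"
      "\<forall>c. path_norm n (matvec (words N) \<sigma> c) \<le> (2 + \<eta>) * path_norm N c"
      "\<forall>a. \<forall>J\<in>words n. matvec (words N) \<sigma> (matvec (words N) (h b) (matvec (words n) \<rho> a)) J = a J"
      using matrix_factorization[OF norm params(1) diag params(2,4,3) large] by blast
    then show "\<exists>\<rho> \<sigma>. \<exists>h\<in>{t, \<lambda>w v. of_bool (w = v) - t w v}.
      (\<forall>a. path_norm N (matvec (words n) \<rho> a) \<le> path_norm n a) \<and>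
      (\<forall>c. path_norm n (matvec (words N) \<sigma> c) \<le> (2 + \<eta>) * path_norm N c) \<and>
      (\<forall>a. \<forall>J\<in>words n. matvec (words N) \<sigma> (matvec (words N) h (matvec (words n) \<rho> a)) J = a J)"
      by (intro exI[of _ \<rho>] exI[of _ \<sigma>] bexI[OF _ h] conjI)
  qed
qed

section \<open>Dyadic intervals and Haar expansions\<close>

text \<open>The binary fraction \<open>0.w\<close>. The first letter is the most significant digit,
  so appending a letter at the end passes to a half of the interval.\<close>

primrec word_value :: "bool list \<Rightarrow> real" where
  "word_value [] = 0"
| "word_value (b # w) = (of_bool b + word_value w) / 2"

definition dyadic_word :: "bool list \<Rightarrow> real set" where
  "dyadic_word w = {word_value w ..< word_value w + 1 / 2 ^ length w}"

primrec digits :: "nat \<Rightarrow> real \<Rightarrow> bool list" where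
  "digits 0 x = []"
| "digits (Suc k) x = (1 / 2 \<le> x) # digits k (2 * x - of_bool (1 / 2 \<le> x))"

lemma length_digits [simp]: "length (digits k x) = k"
  by (induction k arbitrary: x) auto

lemma take_digits: "k \<le> l \<Longrightarrow> take k (digits l x) = digits k x"
proof (induction k arbitrary: l x)
  case (Suc k)
  then show ?case by (cases l) auto
qed simp

lemma word_value_nonneg: "0 \<le> word_value w"
  by (induction w) auto

lemma word_value_le: "word_value w + 1 / 2 ^ length w \<le> 1"
proof (induction w)
  case (Cons b w)
  have eq: "word_value (b # w) + 1 / 2 ^ length (b # w) = (of_bool b + (word_value w + 1 / 2 ^ length w)) / 2"
    by (simp add: field_simps)
  have "(a + v) / 2 \<le> 1" if "a \<le> 1" "v \<le> 1" for a v :: real using that by simp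
  then show ?case unfolding eq using Cons by simp
qed simp

lemma word_value_dyadic: "\<exists>i < 2 ^ length w. word_value w = real i / 2 ^ length w"
proof (induction w)
  case (Cons b w)
  then obtain i where "i < 2 ^ length w" "word_value w = real i / 2 ^ length w" by blast
  then show ?case
    by (intro exI[of _ "of_bool b * 2 ^ length w + i"]) (auto simp: field_simps)
qed simp

text \<open>Induction along the doubling map \<open>2 * x - b\<close>, which carries the half
  selected by \<open>b\<close> onto [0, 1). A wrong first digit moves the point out of [0,
  1).\<close>

lemma mem_dyadic_word_iff: "x \<in> {0..<1} \<Longrightarrow> x \<in> dyadic_word w \<longleftrightarrow> digits (length w) x = w"
proof (induction w arbitrary: x)
  case Nil
  then show ?case by (simp add: dyadic_word_def)
next
  case (Cons b w)
  let ?y = "2 * x - of_bool b"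
  have eq: "x \<in> dyadic_word (b # w) \<longleftrightarrow> ?y \<in> dyadic_word w"
    by (auto simp: dyadic_word_def field_simps)
  show ?case
  proof (cases "b = (1 / 2 \<le> x)")
    case True
    then have "?y \<in> {0..<1}" using Cons.prems by auto
    then show ?thesis using Cons.IH[of ?y] eq True by auto
  next
    case False
    then have "?y \<notin> dyadic_word w"
      using word_value_nonneg[of w] word_value_le[of w] by (cases b) (auto simp: dyadic_word_def)
    then show ?thesis using eq False by auto
  qed
qed

lemma mem_dyadic_word_prefix_iff:
  assumes "x \<in> {0..<1}" "length w \<le> n"
  shows "x \<in> dyadic_word w \<longleftrightarrow> prefix w (digits n x)"
proof -
  have "prefix w (digits n x) \<longleftrightarrow> take (length w) (digits n x) = w"
    by (metis append_eq_conv_conj prefix_def take_is_prefix)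
  then show ?thesis using assms by (simp add: mem_dyadic_word_iff take_digits)
qed

lemma measure_dyadic_word: "measure lebesgue (dyadic_word w) = 1 / 2 ^ length w"
  by (simp add: dyadic_word_def)

lemma dyadic_word_in_intervals: "dyadic_word w \<in> dyadic_intervals"
proof -
  obtain i where i: "i < 2 ^ length w" "word_value w = real i / 2 ^ length w"
    using word_value_dyadic by blast
  then have "dyadic_word w = {(real (Suc i) - 1) / 2 ^ length w ..< real (Suc i) / 2 ^ length w}"
    by (simp add: dyadic_word_def add_divide_distrib add.commute)
  moreover have "1 \<le> Suc i" "Suc i \<le> 2 ^ length w" using i(1) by simp_all
  ultimately show ?thesis unfolding dyadic_intervals_def by blast
qed

lemma dyadic_interval_is_word:
  assumes "I \<in> dyadic_intervals"
  obtains w where "I = dyadic_word w"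
proof -
  obtain m i :: nat where I: "I = {real i / 2 ^ m ..< (real i + 1) / 2 ^ m}" and i: "i < 2 ^ m"
    using dyadic_cases[OF assms] by metis
  define x where "x = real i / 2 ^ m"
  have x: "x \<in> {0..<1}" using i by (simp add: x_def)
  define w where "w = digits m x"
  have len: "length w = m" by (simp add: w_def)
  have mem: "x \<in> dyadic_word w" using mem_dyadic_word_iff[OF x, of w] by (simp add: w_def)
  obtain j where j: "word_value w = real j / 2 ^ m" using word_value_dyadic[of w] by (auto simp: w_def)
  have "real j \<le> real i" "real i < real j + 1"
    using mem by (simp_all add: x_def dyadic_word_def j len field_simps)
  then have "i = j" by linarith
  then have "I = dyadic_word w" by (simp add: I dyadic_word_def j len add_divide_distrib)
  then show ?thesis by (rule that)
qed

text \<open>The measure determines the length of the word, and the digits of the left endpoint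
  determine its letters.\<close>

lemma inj_dyadic_word: "inj dyadic_word"
proof (rule injI)
  fix v w assume eq: "dyadic_word v = dyadic_word w"
  have "(2::real) ^ length v = 2 ^ length w"
    using measure_dyadic_word[of v] measure_dyadic_word[of w] eq by simp
  then have len: "length v = length w" by simp
  have mem: "word_value v \<in> dyadic_word v" by (simp add: dyadic_word_def)
  then have x: "word_value v \<in> {0..<1}" using dyadic_subset[OF dyadic_word_in_intervals] by blast
  have "digits (length v) (word_value v) = v" using mem mem_dyadic_word_iff[OF x] by blast
  moreover have "digits (length w) (word_value v) = w" using mem mem_dyadic_word_iff[OF x] eq by blast
  ultimately show "v = w" unfolding len by (rule trans[OF sym])
qed

lemma dyadic_upto_eq: "dyadic_upto m = dyadic_word ` words m"
proof
  show "dyadic_upto m \<subseteq> dyadic_word ` words m"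
  proof
    fix I assume "I \<in> dyadic_upto m"
    then obtain k where k: "k \<le> m" "I \<in> dyadic_intervals" "measure lebesgue I = 1 / 2 ^ k"
      by (auto simp: dyadic_upto_def dyadic_level_def)
    obtain w where w: "I = dyadic_word w" using dyadic_interval_is_word[OF k(2)] .
    have "(2::real) ^ length w = 2 ^ k" using k(3) by (simp add: w measure_dyadic_word)
    then show "I \<in> dyadic_word ` words m" using w k(1) by (simp add: words_def)
  qed
  show "dyadic_word ` words m \<subseteq> dyadic_upto m"
    by (auto simp: dyadic_upto_def dyadic_level_def words_def dyadic_word_in_intervals measure_dyadic_word)
qed

section \<open>Haar expansions in word coordinates\<close>

definition synth :: "nat \<Rightarrow> (bool list \<Rightarrow> real) \<Rightarrow> real \<Rightarrow> real" where
  "synth m c x = (\<Sum>w\<in>words m. c w * haar (dyadic_word w) x)"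

definition word_coeff :: "(real \<Rightarrow> real) \<Rightarrow> bool list \<Rightarrow> real" where
  "word_coeff f w = haar_coeff f (dyadic_word w)"

lemma sum_dyadic_upto: "(\<Sum>I\<in>dyadic_upto m. F I) = (\<Sum>w\<in>words m. F (dyadic_word w))"
  unfolding dyadic_upto_eq by (simp add: sum.reindex inj_on_subset[OF inj_dyadic_word])

lemma synth_eq: "synth m c = (\<lambda>x. \<Sum>I\<in>dyadic_upto m. c (inv dyadic_word I) * haar I x)"
  by (simp add: fun_eq_iff synth_def sum_dyadic_upto inv_f_f[OF inj_dyadic_word])

lemma word_coeff_synth: "w \<in> words m \<Longrightarrow> word_coeff (synth m c) w = c w"
  unfolding word_coeff_def synth_eq
  by (subst haar_coeff_sum[OF finite_dyadic_upto dyadic_upto_subset dyadic_word_in_intervals])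
    (simp add: dyadic_upto_eq inv_f_f[OF inj_dyadic_word])

lemma SL_eq: "SL m = range (synth m)"
proof
  show "SL m \<subseteq> range (synth m)"
  proof
    fix f assume "f \<in> SL m"
    then obtain a where "f = (\<lambda>x. \<Sum>I\<in>dyadic_upto m. a I * haar I x)" unfolding SL_def by blast
    then have "f = synth m (\<lambda>w. a (dyadic_word w))" by (simp add: fun_eq_iff synth_def sum_dyadic_upto)
    then show "f \<in> range (synth m)" by blast
  qed
  show "range (synth m) \<subseteq> SL m" unfolding SL_def synth_eq by auto
qed

lemma synth_in_SL [simp]: "synth m c \<in> SL m"
  by (simp add: SL_eq)

lemma synth_cong: "(\<And>w. w \<in> words m \<Longrightarrow> c w = d w) \<Longrightarrow> synth m c = synth m d"
  by (simp add: synth_def fun_eq_iff)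

lemma synth_word_coeff: "f \<in> SL m \<Longrightarrow> synth m (word_coeff f) = f"
  unfolding SL_eq by (auto intro!: synth_cong simp: word_coeff_synth)

lemma synth_add: "synth m (\<lambda>w. c w + d w) x = synth m c x + synth m d x"
  by (simp add: synth_def sum.distrib algebra_simps)

lemma synth_scale: "synth m (\<lambda>w. k * c w) x = k * synth m c x"
  by (simp add: synth_def sum_distrib_left mult.assoc)

lemma synth_diff: "synth m (\<lambda>w. c w - d w) x = synth m c x - synth m d x"
  by (simp add: synth_def sum_subtractf algebra_simps)

lemma square_sum_digits:
  assumes "x \<in> {0..<1}"
  shows "sqrt (\<Sum>I\<in>dyadic_upto m. (c (inv dyadic_word I))\<^sup>2 * (haar I x)\<^sup>2) = L2_set c {w. prefix w (digits m x)}"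
proof -
  have "(\<Sum>I\<in>dyadic_upto m. (c (inv dyadic_word I))\<^sup>2 * (haar I x)\<^sup>2)
      = (\<Sum>w\<in>words m. if prefix w (digits m x) then (c w)\<^sup>2 else 0)"
    unfolding sum_dyadic_upto
  proof (intro sum.cong refl)
    fix w assume "w \<in> words m"
    then have "(haar (dyadic_word w) x)\<^sup>2 = of_bool (prefix w (digits m x))"
      using mem_dyadic_word_prefix_iff[OF assms, of w m] haar_square[OF dyadic_word_in_intervals, of w x]
      by (simp add: words_def power2_eq_square indicator_def)
    then show "(c (inv dyadic_word (dyadic_word w)))\<^sup>2 * (haar (dyadic_word w) x)\<^sup>2
        = (if prefix w (digits m x) then (c w)\<^sup>2 else 0)"
      by (simp add: inv_f_f[OF inj_dyadic_word])
  qed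
  also have "\<dots> = (\<Sum>w | w \<in> words m \<and> prefix w (digits m x). (c w)\<^sup>2)"
    by (rule sum.inter_filter[symmetric]) simp
  also have "{w. w \<in> words m \<and> prefix w (digits m x)} = {w. prefix w (digits m x)}"
    using prefixes_subset_words[of "digits m x" m] by auto
  finally show ?thesis by (simp add: L2_set_def)
qed

text \<open>Each interval on which the square function is constant has positive measure, so the
  essential supremum is a true maximum over the words of length \<open>m\<close>.\<close>

lemma SL_norm_synth: "SL_norm (synth m c) = path_norm m c"
proof -
  let ?M = "lebesgue_on {0..<1::real}"
  define f where "f x = ereal (sqrt (\<Sum>I\<in>dyadic_upto m. (c (inv dyadic_word I))\<^sup>2 * (haar I x)\<^sup>2))" for x
  have f: "f x = ereal (L2_set c {w. prefix w (digits m x)})" if "x \<in> {0..<1}" for x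
    unfolding f_def square_sum_digits[OF that] ..
  have haar [measurable]: "haar I \<in> borel_measurable ?M" if "I \<in> dyadic_upto m" for I
    using integral_haar(1)[of I] dyadic_upto_subset that by auto
  have meas: "f \<in> borel_measurable ?M" unfolding f_def by measurable
  have "esssup ?M f = ereal (path_norm m c)"
  proof (rule antisym)
    show "esssup ?M f \<le> ereal (path_norm m c)"
      by (intro esssup_I meas AE_I2) (simp add: f path_norm_ge)
    have "ereal (L2_set c {w. prefix w y}) \<le> esssup ?M f" if y: "length y = m" for y
    proof (rule ccontr)
      assume "\<not> ?thesis"
      moreover have "f x = ereal (L2_set c {w. prefix w y})" if "x \<in> dyadic_word y" for x
      proof -
        have "x \<in> {0..<1}" using dyadic_subset[OF dyadic_word_in_intervals] that by blast
        then show ?thesis using mem_dyadic_word_iff[of x y] that y by (simp add: f)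
      qed
      ultimately have "AE x in ?M. x \<notin> dyadic_word y"
        using esssup_AE[of f ?M] by (auto elim!: eventually_mono)
      then have "AE x in lebesgue. x \<notin> dyadic_word y"
        using dyadic_subset[OF dyadic_word_in_intervals, of y]
        by (subst (asm) AE_restrict_space_iff) (auto elim!: eventually_mono)
      then have "dyadic_word y \<in> null_sets lebesgue"
        by (subst (asm) AE_iff_null_sets[symmetric]) (auto simp: dyadic_word_def)
      then have "measure lebesgue (dyadic_word y) = 0" by (simp add: null_sets_def measure_def)
      then show False by (simp add: measure_dyadic_word)
    qed
    note le = this
    have "path_norm m c \<in> (\<lambda>x. L2_set c {w. prefix w x}) ` {x. length x = m}"
      unfolding path_norm_def by (rule Max_in) (auto intro: exI[of _ "replicate m False"])
    then show "ereal (path_norm m c) \<le> esssup ?M f" using le by auto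
  qed
  then show ?thesis
    unfolding synth_eq SL_norm_sum[OF finite_dyadic_upto dyadic_upto_subset] f_def[symmetric] by simp
qed

lemma word_coeff_add: "f \<in> SL m \<Longrightarrow> g \<in> SL m \<Longrightarrow> w \<in> words m \<Longrightarrow> word_coeff (\<lambda>x. f x + g x) w = word_coeff f w + word_coeff g w"
  unfolding SL_eq by (auto simp: word_coeff_synth simp flip: synth_add)

lemma word_coeff_scale: "f \<in> SL m \<Longrightarrow> w \<in> words m \<Longrightarrow> word_coeff (\<lambda>x. k * f x) w = k * word_coeff f w"
  unfolding SL_eq by (auto simp: word_coeff_synth simp flip: synth_scale)

lemma word_coeff_diff: "f \<in> SL m \<Longrightarrow> g \<in> SL m \<Longrightarrow> w \<in> words m \<Longrightarrow> word_coeff (\<lambda>x. f x - g x) w = word_coeff f w - word_coeff g w"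
  unfolding SL_eq by (auto simp: word_coeff_synth simp flip: synth_diff)

lemma SL_norm_eq: "f \<in> SL m \<Longrightarrow> SL_norm f = path_norm m (word_coeff f)"
  using SL_norm_synth[of m "word_coeff f"] by (simp add: synth_word_coeff)

lemma SL_norm_nonneg: "f \<in> SL m \<Longrightarrow> 0 \<le> SL_norm f"
  by (simp add: SL_norm_eq path_norm_nonneg)

section \<open>Operators and their matrices\<close>

lemma SL_opnorm_bound:
  assumes T: "SL_operator (SL m) (SL l) T" and le: "SL_opnorm (SL m) T \<le> K" and f: "f \<in> SL m"
  shows "SL_norm (T f) \<le> K * SL_norm f"
proof -
  obtain C where C: "\<And>f. f \<in> SL m \<Longrightarrow> SL_norm (T f) \<le> C * SL_norm f"
    using T unfolding SL_operator_def by blast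
  have "bdd_above ((\<lambda>f. SL_norm (T f) / SL_norm f) ` SL m)"
  proof (rule bdd_aboveI2)
    fix g assume g: "g \<in> SL m"
    \<comment> \<open>The quotient is 0 where the norm vanishes, while \<open>C\<close> might be
      negative.\<close>
    show "SL_norm (T g) / SL_norm g \<le> max C 0"
    proof (cases "SL_norm g = 0")
      case False
      then have "0 < SL_norm g" using SL_norm_nonneg[OF g] by simp
      then have "SL_norm (T g) / SL_norm g \<le> C" using C[OF g] by (simp add: pos_divide_le_eq)
      then show ?thesis by simp
    qed simp
  qed
  then have "SL_norm (T f) / SL_norm f \<le> K"
    using le cSUP_upper[OF f, of "\<lambda>f. SL_norm (T f) / SL_norm f"] unfolding SL_opnorm_def by linarith
  \<comment> \<open>Where the norm of \<open>f\<close> vanishes the quotient says nothing, and the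
    bound with \<open>C\<close> settles the claim.\<close>
  then show ?thesis
    using C[OF f] SL_norm_nonneg[OF f] by (cases "SL_norm f = 0") (auto simp: divide_le_eq)
qed

definition matrix_operator :: "nat \<Rightarrow> nat \<Rightarrow> (bool list \<Rightarrow> bool list \<Rightarrow> real) \<Rightarrow> (real \<Rightarrow> real) \<Rightarrow> real \<Rightarrow> real" where
  "matrix_operator m l A f = synth l (matvec (words m) A (word_coeff f))"

text \<open>The nonnegativity claim allows the bounds for two operator norms to be multiplied
  later.\<close>

lemma matrix_operator:
  assumes A: "\<And>c. path_norm l (matvec (words m) A c) \<le> K * path_norm m c" and "0 \<le> K"
  shows "SL_operator (SL m) (SL l) (matrix_operator m l A)"
    and "SL_opnorm (SL m) (matrix_operator m l A) \<le> K"
    and "0 \<le> SL_opnorm (SL m) (matrix_operator m l A)"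
proof -
  let ?T = "matrix_operator m l A"
  have bound: "SL_norm (?T f) \<le> K * SL_norm f" if "f \<in> SL m" for f
    using A[of "word_coeff f"] that by (simp add: matrix_operator_def SL_norm_synth SL_norm_eq)
  have add: "matvec (words m) A (word_coeff (\<lambda>x. f x + g x))
      = (\<lambda>w. matvec (words m) A (word_coeff f) w + matvec (words m) A (word_coeff g) w)"
    if "f \<in> SL m" "g \<in> SL m" for f g
    using that by (simp add: fun_eq_iff matvec_def word_coeff_add[of _ m] distrib_left sum.distrib)
  have scale: "matvec (words m) A (word_coeff (\<lambda>x. k * f x)) = (\<lambda>w. k * matvec (words m) A (word_coeff f) w)"
    if "f \<in> SL m" for f k
    using that by (simp add: fun_eq_iff matvec_def word_coeff_scale[of _ m] sum_distrib_left mult.left_commute)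
  show "SL_operator (SL m) (SL l) ?T"
    unfolding SL_operator_def
  proof (intro conjI ballI allI)
    show "?T (\<lambda>x. f x + g x) = (\<lambda>x. ?T f x + ?T g x)" if "f \<in> SL m" "g \<in> SL m" for f g
      using that by (simp add: fun_eq_iff matrix_operator_def add synth_add)
    show "?T (\<lambda>x. k * f x) = (\<lambda>x. k * ?T f x)" if "f \<in> SL m" for f k
      using that by (simp add: fun_eq_iff matrix_operator_def scale synth_scale)
    show "\<exists>K. \<forall>f\<in>SL m. SL_norm (?T f) \<le> K * SL_norm f" using bound by blast
  qed (simp add: matrix_operator_def)
  have ratio: "SL_norm (?T f) / SL_norm f \<le> K" if "f \<in> SL m" for f
    using bound[OF that] SL_norm_nonneg[OF that] \<open>0 \<le> K\<close> by (cases "SL_norm f = 0") (auto simp: divide_le_eq)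
  show "SL_opnorm (SL m) ?T \<le> K"
    unfolding SL_opnorm_def by (rule cSUP_least) (use ratio in \<open>auto simp: SL_eq\<close>)
  have "bdd_above ((\<lambda>f. SL_norm (?T f) / SL_norm f) ` SL m)" using ratio by (rule bdd_aboveI2)
  from cSUP_upper[OF synth_in_SL[of m "\<lambda>_. 0"] this]
  have "SL_norm (?T (synth m (\<lambda>_. 0))) / SL_norm (synth m (\<lambda>_. 0)) \<le> SL_opnorm (SL m) ?T"
    unfolding SL_opnorm_def .
  moreover have "0 \<le> SL_norm (?T (synth m (\<lambda>_. 0))) / SL_norm (synth m (\<lambda>_. 0))"
    by (simp add: matrix_operator_def SL_norm_synth path_norm_nonneg)
  ultimately show "0 \<le> SL_opnorm (SL m) ?T" by linarith
qed

lemma operator_matrix: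
  assumes T: "SL_operator (SL m) (SL l) T" and w: "w \<in> words l"
  shows "word_coeff (T (synth m c)) w = matvec (words m) (\<lambda>w v. word_coeff (T (haar (dyadic_word v))) w) c w"
proof -
  have add: "T (\<lambda>x. f x + g x) = (\<lambda>x. T f x + T g x)" if "f \<in> SL m" "g \<in> SL m" for f g
    using T that unfolding SL_operator_def by blast
  have scale: "T (\<lambda>x. k * f x) = (\<lambda>x. k * T f x)" if "f \<in> SL m" for f k
    using T that unfolding SL_operator_def by blast
  have maps: "T f \<in> SL l" if "f \<in> SL m" for f
    using T that unfolding SL_operator_def by blast
  \<comment> \<open>Additivity of \<open>T\<close> is available only on \<open>SL m\<close>, so the
    partial sums in the induction must lie there.\<close>
  have part: "(\<lambda>x. \<Sum>v\<in>V. c v * haar (dyadic_word v) x) \<in> SL m" if "V \<subseteq> words m" for V c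
  proof -
    have "(\<lambda>x. \<Sum>v\<in>V. c v * haar (dyadic_word v) x) = synth m (\<lambda>v. if v \<in> V then c v else 0)"
      unfolding synth_def
      by (intro ext sum.mono_neutral_cong_left) (use that in auto)
    then show ?thesis by simp
  qed
  have haar: "haar (dyadic_word v) \<in> SL m" if "v \<in> words m" for v
    using part[of "{v}" "\<lambda>_. 1"] that by simp
  have zero: "word_coeff (\<lambda>x. 0) w = 0"
    using word_coeff_synth[OF w, of "\<lambda>_. 0"] by (simp add: synth_def[abs_def])
  have "word_coeff (T (\<lambda>x. \<Sum>v\<in>V. c v * haar (dyadic_word v) x)) w = (\<Sum>v\<in>V. word_coeff (T (haar (dyadic_word v))) w * c v)"
    if "V \<subseteq> words m" for V
    using finite_subset[OF that finite_words] that
  proof (induction V)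
    case empty
    show ?case using scale[of "synth m c" 0] zero by simp
  next
    case (insert v V)
    let ?s = "\<lambda>x. \<Sum>v\<in>V. c v * haar (dyadic_word v) x"
    have s: "?s \<in> SL m" and h: "haar (dyadic_word v) \<in> SL m" using insert part haar by auto
    have ch: "(\<lambda>x. c v * haar (dyadic_word v) x) \<in> SL m"
      using part[of "{v}" c] insert.prems by simp
    have "T (\<lambda>x. \<Sum>v\<in>insert v V. c v * haar (dyadic_word v) x)
        = (\<lambda>x. (c v * T (haar (dyadic_word v)) x) + T ?s x)"
      using insert.hyps add[OF ch s] scale[OF h, of "c v"] by simp
    moreover have "(\<lambda>x. c v * T (haar (dyadic_word v)) x) \<in> SL l"
      using maps[OF ch] scale[OF h, of "c v"] by simp
    ultimately show ?case
      using insert word_coeff_add[of "\<lambda>x. c v * T (haar (dyadic_word v)) x" l "T ?s" w] word_coeff_scale[of _ l w] maps s h w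
      by (simp add: mult.commute)
  qed
  from this[of "words m"] show ?thesis
    by (simp add: synth_def[abs_def] matvec_def)
qed

section \<open>Transfer from matrices to operators\<close>

theorem theorem2p2:
  fixes n :: nat and \<Gamma> \<eta> :: real
  assumes "\<Gamma> > 0" and "\<eta> > 0"
  shows "\<exists>N::nat. \<forall>T. SL_operator (SL N) (SL N) T \<and> SL_opnorm (SL N) T \<le> \<Gamma> \<longrightarrow>
           (\<exists>R S. SL_operator (SL n) (SL N) R \<and> SL_operator (SL N) (SL n) S \<and>
              (\<exists>H \<in> {T, (\<lambda>f x. f x - T f x)}. \<forall>f \<in> SL n. S (H (R f)) = f) \<and>
              SL_opnorm (SL n) R * SL_opnorm (SL N) S \<le> 2 + \<eta>)"
proof -
  obtain N where N: "\<And>t. (\<forall>c. path_norm N (matvec (words N) t c) \<le> \<Gamma> * path_norm N c) \<Longrightarrow>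
    (\<exists>\<rho> \<sigma>. \<exists>h\<in>{t, \<lambda>w v. of_bool (w = v) - t w v}.
      (\<forall>a. path_norm N (matvec (words n) \<rho> a) \<le> path_norm n a) \<and>
      (\<forall>c. path_norm n (matvec (words N) \<sigma> c) \<le> (2 + \<eta>) * path_norm N c) \<and>
      (\<forall>a. \<forall>J\<in>words n. matvec (words N) \<sigma> (matvec (words N) h (matvec (words n) \<rho> a)) J = a J))"
    using path_norm_factorization[OF assms, of n] by blast
  show ?thesis
  proof (intro exI[of _ N] allI impI, elim conjE)
    fix T assume T: "SL_operator (SL N) (SL N) T" and norm: "SL_opnorm (SL N) T \<le> \<Gamma>"
    define t where "t w v = word_coeff (T (haar (dyadic_word v))) w" for w v
    have Tmaps: "T f \<in> SL N" if "f \<in> SL N" for f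
      using T that unfolding SL_operator_def by blast
    have t: "word_coeff (T (synth N c)) w = matvec (words N) t c w" if "w \<in> words N" for c w
      unfolding t_def using operator_matrix[OF T that] by simp
    have bound: "path_norm N (matvec (words N) t c) \<le> \<Gamma> * path_norm N c" for c
    proof -
      have "path_norm N (matvec (words N) t c) = path_norm N (word_coeff (T (synth N c)))"
        by (rule path_norm_cong) (simp add: t)
      also have "\<dots> = SL_norm (T (synth N c))" by (simp add: SL_norm_eq[of _ N] Tmaps)
      also have "\<dots> \<le> \<Gamma> * path_norm N c"
        using SL_opnorm_bound[OF T norm, of "synth N c"] by (simp add: SL_norm_synth)
      finally show ?thesis .
    qed
    obtain \<rho> \<sigma> h where h: "h \<in> {t, \<lambda>w v. of_bool (w = v) - t w v}"
      and \<rho>': "\<forall>a. path_norm N (matvec (words n) \<rho> a) \<le> path_norm n a"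
      and \<sigma>': "\<forall>c. path_norm n (matvec (words N) \<sigma> c) \<le> (2 + \<eta>) * path_norm N c"
      and inv': "\<forall>a. \<forall>J\<in>words n. matvec (words N) \<sigma> (matvec (words N) h (matvec (words n) \<rho> a)) J = a J"
      using N[of t, OF allI[OF bound]] by (elim exE bexE conjE)
    have \<rho>: "path_norm N (matvec (words n) \<rho> a) \<le> 1 * path_norm n a" for a using \<rho>' by simp
    note \<sigma> = spec[OF \<sigma>'] and inv = bspec[OF spec[OF inv']]
    define R S where "R = matrix_operator n N \<rho>" and "S = matrix_operator N n \<sigma>"
    \<comment> \<open>Only the matrix \<open>h\<close> is handed back; comparing it with
      \<open>t\<close> tells which operator it represents.\<close>
    define H where "H = (if h = t then T else (\<lambda>f x. f x - T f x))"
    have H: "word_coeff (H (synth N c)) w = matvec (words N) h c w" if w: "w \<in> words N" for c w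
    proof (cases "h = t")
      case True
      then show ?thesis by (simp add: H_def t w)
    next
      case False
      have "(\<Sum>v\<in>words N. of_bool (w = v) * c v) = c w"
        using w by (simp add: of_bool_def if_distrib[of "\<lambda>x. x * _"] cong: if_cong)
      then have "matvec (words N) h c w = c w - matvec (words N) t c w"
        using False h by (auto simp: matvec_def left_diff_distrib sum_subtractf)
      then show ?thesis
        using False w by (simp add: H_def word_coeff_diff[of _ N] Tmaps word_coeff_synth t)
    qed
    have "S (H (R f)) = f" if "f \<in> SL n" for f
    proof -
      have "S (H (R f)) = synth n (word_coeff f)"
        unfolding S_def matrix_operator_def
      proof (rule synth_cong)
        fix J assume J: "J \<in> words n"
        have "matvec (words N) \<sigma> (word_coeff (H (R f))) J
            = matvec (words N) \<sigma> (matvec (words N) h (matvec (words n) \<rho> (word_coeff f))) J"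
          unfolding matvec_def[of "words N" \<sigma>] R_def matrix_operator_def
          by (intro sum.cong refl) (simp add: H)
        then show "matvec (words N) \<sigma> (word_coeff (H (R f))) J = word_coeff f J" using inv[OF J] by simp
      qed
      then show ?thesis using that by (simp add: synth_word_coeff)
    qed
    moreover have "H \<in> {T, (\<lambda>f x. f x - T f x)}" by (simp add: H_def)
    \<comment> \<open>\<open>R\<close> is a contraction, so the whole constant falls on
      \<open>S\<close>.\<close>
    moreover have "SL_opnorm (SL n) R * SL_opnorm (SL N) S \<le> 1 * (2 + \<eta>)"
      unfolding R_def S_def
      by (intro mult_mono matrix_operator[OF \<rho>] matrix_operator[OF \<sigma>]) (use assms in auto)
    moreover have "SL_operator (SL n) (SL N) R" "SL_operator (SL N) (SL n) S"
      unfolding R_def S_def using assms by (auto intro!: matrix_operator[OF \<rho>] matrix_operator[OF \<sigma>])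
    ultimately show "\<exists>R S. SL_operator (SL n) (SL N) R \<and> SL_operator (SL N) (SL n) S \<and>
              (\<exists>H \<in> {T, (\<lambda>f x. f x - T f x)}. \<forall>f \<in> SL n. S (H (R f)) = f) \<and>
              SL_opnorm (SL n) R * SL_opnorm (SL N) S \<le> 2 + \<eta>"
      by (intro exI[of _ R] exI[of _ S] conjI bexI[of _ H] ballI) simp_all
  qed
qed

end
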